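(* Let $\alpha\in\mathcal A_n$ be an arc. Then the rays of the type cone of the $\alpha$-Cambrian fan $\mathcal F_\alpha$ are precisely the rays spanned by the shard polytopes $\mathrm{SP}(\alpha')$ for the arcs $\alpha'$ forcing $\alpha$; that is, each such $\mathrm{SP}(\alpha')$ spans a ray of this type cone, and every ray of this type cone is spanned by such an $\mathrm{SP}(\alpha')$.
   Context: $]a,b[=\{a+1,\dots,b-1\}$, $(\mathbf e_i)$ the standard basis of $\mathbb R^n$, $\mathbb H=\{\mathbf x\in\mathbb R^n:\sum_ix_i=0\}$. An arc is a quadruple $\alpha=(a,b,A,B)$ with $1\le a<b\le n$ and $A\sqcup B=]a,b[$; $\mathcal A_n$ is the set of arcs. An arc $\alpha'=(a',b',A',B')$ forces $\alpha=(a,b,A,B)$ if $a\le a'<b'\le b$, $A'\subseteq A$, $B'\subseteq B$ (every arc forces itself). The shard of $\alpha$ is $S(\alpha)=\{\mathbf x\in\mathbb H: x_a=x_b,\ x_a\ge x_{a'}\ \forall a'\in A,\ x_a\le x_{b'}\ \forall b'\in B\}$. The $\alpha$-Cambrian fan $\mathcal F_\alpha$ is the complete fan in $\mathbb H$ whose maximal cones are the closures of the connected components of $\mathbb H\setminus\bigcup S(\alpha')$, the union over all arcs $\alpha'$ forcing $\alpha$. An $\alpha$-alternating matching is a (possibly empty) set $M=\{a_1<b_1<\dots<a_k<b_k\}$ with $a\le a_1$, $b_k\le b$, $a_i\in\{a\}\cup A$, $b_i\in B\cup\{b\}$; $\chi(M)=\sum_i(\mathbf e_{a_i}-\mathbf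 e_{b_i})$; $\mathrm{SP}(\alpha)=\mathrm{conv}\{\chi(M)\}$. The (closed) type cone of a complete fan $\mathcal F$ in $\mathbb H$ is the set of polytopes in $\mathbb H$ whose normal fan (within $\mathbb H$) is coarser than $\mathcal F$ (each normal cone is a union of cones of $\mathcal F$), taken modulo translation; it is a pointed polyhedral cone with respect to Minkowski addition and nonnegative dilation, and its rays are the half-lines $\{\lambda P:\lambda\ge0\}$ (up to translation) of its extremal elements. *)

theory Defs
  imports "HOL-Analysis.Analysis"
begin

text \<open>
  The index set \<open>{1, \<dots>, n}\<close> is rendered by a finite linearly ordered type \<open>'n\<close> with
  \<open>CARD('n) = n\<close>: only the order of the indices matters, and every \<open>n \<ge> 1\<close> arises as the
  cardinality of such a type.
\<close>

type_synonym 'n arc = "'n \<times> 'n \<times> 'n set \<times> 'n set"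

definition arcs :: "'n::{finite,linorder} arc set" where
  "arcs = {(a, b, A, B). a < b \<and> A \<union> B = {a<..<b} \<and> A \<inter> B = {}}"

fun forces :: "'n::{finite,linorder} arc \<Rightarrow> 'n arc \<Rightarrow> bool" where
  "forces (a', b', A', B') (a, b, A, B) \<longleftrightarrow>
     a \<le> a' \<and> a' < b' \<and> b' \<le> b \<and> A' \<subseteq> A \<and> B' \<subseteq> B"

definition hyperplane0 :: "(real ^ 'n::finite) set" where
  "hyperplane0 = {x. (\<Sum>i\<in>UNIV. x $ i) = 0}"

fun shard :: "'n::{finite,linorder} arc \<Rightarrow> (real ^ 'n::{finite,linorder}) set" where
  "shard (a, b, A, B) = {x \<in> hyperplane0.
     x $ a = x $ b \<and> (\<forall>a'\<in>A. x $ a \<ge> x $ a') \<and> (\<forall>b'\<in>B. x $ a \<le> x $ b')}"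

definition cambrian_maximal_cones :: "'n::{finite,linorder} arc \<Rightarrow> (real ^ 'n::{finite,linorder}) set set" where
  "cambrian_maximal_cones \<alpha> =
     closure ` components (hyperplane0 - (\<Union>\<alpha>'\<in>{\<alpha>' \<in> arcs. forces \<alpha>' \<alpha>}. shard \<alpha>'))"

text \<open>
  A fan is represented by the set of all its cones, i.e. the nonempty faces of its maximal cones
  (\<open>face_of\<close> also counts the empty set as a face). The cones need not be pointed.
\<close>

definition cambrian_fan :: "'n::{finite,linorder} arc \<Rightarrow> (real ^ 'n::{finite,linorder}) set set" where
  "cambrian_fan \<alpha> = {F. F \<noteq> {} \<and> (\<exists>C\<in>cambrian_maximal_cones \<alpha>. F face_of C)}"

text \<open>
  An alternating matching \<open>{a\<^sub>1 < b\<^sub>1 < \<dots> < a\<^sub>k < b\<^sub>k}\<close> is represented by the list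
  \<open>[(a\<^sub>1, b\<^sub>1), \<dots>, (a\<^sub>k, b\<^sub>k)]\<close>, which the set determines by sorting.
\<close>

fun alternating_matching :: "'n::{finite,linorder} arc \<Rightarrow> ('n \<times> 'n) list \<Rightarrow> bool" where
  "alternating_matching (a, b, A, B) M \<longleftrightarrow>
     sorted_wrt (<) (concat (map (\<lambda>(p, q). [p, q]) M)) \<and>
     (\<forall>(p, q)\<in>set M. a \<le> p \<and> q \<le> b \<and> p \<in> {a} \<union> A \<and> q \<in> B \<union> {b})"

definition characteristic_vector :: "('n \<times> 'n) list \<Rightarrow> real ^ 'n::finite" where
  "characteristic_vector M = (\<Sum>(p, q)\<leftarrow>M. axis p 1 - axis q 1)"

definition shard_polytope :: "'n::{finite,linorder} arc \<Rightarrow> (real ^ 'n::{finite,linorder}) set" where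
  "shard_polytope \<alpha> = convex hull (characteristic_vector ` {M. alternating_matching \<alpha> M})"

text \<open>
  Normal cones consist of outer normals: the linear functionals maximised on the given face.
  With inner normals, shard polytopes would not be compatible with the above sign convention
  for shards.
\<close>

definition normal_cone :: "(real ^ 'n::finite) set \<Rightarrow> (real ^ 'n) set \<Rightarrow> (real ^ 'n) set" where
  "normal_cone P F = {u \<in> hyperplane0. \<forall>x\<in>F. \<forall>y\<in>P. u \<bullet> y \<le> u \<bullet> x}"

definition normal_fan :: "(real ^ 'n::finite) set \<Rightarrow> (real ^ 'n) set set" where
  "normal_fan P = normal_cone P ` {F. F face_of P \<and> F \<noteq> {}}"

definition coarsens :: "(real ^ 'n::finite) set set \<Rightarrow> (real ^ 'n) set set \<Rightarrow> bool" where
  "coarsens \<N> \<F> \<longleftrightarrow> (\<forall>N\<in>\<N>. \<exists>\<G>\<subseteq>\<F>. N = \<Union>\<G>)"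

definition translation_class :: "(real ^ 'n::finite) set \<Rightarrow> (real ^ 'n) set set" where
  "translation_class P = (\<lambda>v. (+) v ` P) ` hyperplane0"

definition type_cone :: "(real ^ 'n::finite) set set \<Rightarrow> (real ^ 'n) set set set" where
  "type_cone \<F> = translation_class `
     {P. polytope P \<and> P \<noteq> {} \<and> P \<subseteq> hyperplane0 \<and> coarsens (normal_fan P) \<F>}"

definition spanned_ray :: "(real ^ 'n::finite) set \<Rightarrow> (real ^ 'n) set set set" where
  "spanned_ray P = {translation_class ((*\<^sub>R) c ` P) | c. 0 \<le> c}"

text \<open>
  \<open>Q + R\<close> is the Minkowski sum. The zero of the cone of translation classes is the class of
  points; it is not extremal, so \<open>{0}\<close> is not a ray.
\<close>

definition extremal_in :: "(real ^ 'n::finite) set set set \<Rightarrow> (real ^ 'n) set \<Rightarrow> bool" where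
  "extremal_in K P \<longleftrightarrow>
     translation_class P \<in> K \<and> translation_class P \<noteq> translation_class {0} \<and>
     (\<forall>Q R. translation_class Q \<in> K \<and> translation_class R \<in> K \<and>
        translation_class (Q + R) = translation_class P \<longrightarrow>
        translation_class Q \<in> spanned_ray P \<and> translation_class R \<in> spanned_ray P)"

definition cone_rays :: "(real ^ 'n::finite) set set set \<Rightarrow> (real ^ 'n) set set set set" where
  "cone_rays K = spanned_ray ` {P. extremal_in K P}"

end

theory Submission
  imports Defs
begin

text \<open>
  A polytope \<open>P\<close> belongs to the type cone iff every vector at which the maximiser over \<open>P\<close> is not unique
  (a kink of the support function) lies on a shard. Its support function is then linear on the cones
  of the braid arrangement, so that up to translation \<open>P\<close> is determined by the set function
  \<open>F S = max {\<Sum>i\<in>S. y\<^sub>i | y \<in> P}\<close>. The kinks along \<open>x\<^sub>c = x\<^sub>d\<close> are measured by the mixed differences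
  \<open>F (S + c) + F (S + d) - F S - F (S + c + d)\<close>, which are nonnegative, and which vanish unless
  \<open>a \<le> c < d \<le> b\<close> and \<open>S\<close> agrees with \<open>B\<close> between \<open>c\<close> and \<open>d\<close>.

  For each arc \<open>(c, d)\<close> forcing \<open>\<alpha>\<close> a critical set \<open>S\<close> is chosen such that the mixed difference at \<open>S\<close>
  is 1 for the shard polytope of \<open>(c, d)\<close> and 0 for the shard polytopes of all other arcs. A set function
  with the above vanishing property all of whose mixed differences at critical sets are 0 is modular.
  Hence these mixed differences are coordinates that identify the type cone with an orthant, whose
  unit vectors are the shard polytopes.
\<close>

section \<open>Maximisers and kinks\<close>

text \<open>The delicate choice is that of the indices of \<open>S\<close> outside [c, d]. The wall
  where the entries at \<open>c\<close> and \<open>d\<close> agree dictates only the part of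
  \<open>S\<close> between them; for a bad choice of the rest, shard polytopes of longer arcs
  contribute too. The choice made turns the matrix of mixed differences into the identity, not
  merely a triangular matrix, so that nonnegativity of mixed differences is at once nonnegativity of
  coordinates. The other obstacle is the fan. Its cones come from components of a complement, and
  shards are only pieces of hyperplanes, so convexity of these components is not visible. Passing
  from the fan to kinks uses only that components are open in the hyperplane; the way back uses
  convexity, so that normal cones cut faces out of the closures. This convexity is drawn from the
  shard polytopes themselves: the kinks of their Minkowski sum are exactly the walls. Kinks are
  taken in the whole space because indicator vectors do not lie in the hyperplane; kinks of
  polytopes in the hyperplane, and walls, are invariant under adding multiples of the all-ones
  vector.\<close>

definition maximizes :: "'a::real_inner set \<Rightarrow> 'a \<Rightarrow> 'a \<Rightarrow> bool" where
  "maximizes P u v \<longleftrightarrow> v \<in> P \<and> (\<forall>y\<in>P. u \<bullet> y \<le> u \<bullet> v)"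

text \<open>The directions in which the support function is not differentiable; for a polytope, the
  union of the normal cones, in the whole space, of its faces of positive dimension.\<close>

definition kinks :: "'a::real_inner set \<Rightarrow> 'a set" where
  "kinks P = {u. \<exists>v w. v \<noteq> w \<and> maximizes P u v \<and> maximizes P u w}"

definition supp :: "'a::real_inner set \<Rightarrow> 'a \<Rightarrow> real" where
  "supp P u = (SUP y\<in>P. u \<bullet> y)"

lemma supp_eq: "maximizes P u v \<Longrightarrow> supp P u = u \<bullet> v"
  unfolding supp_def maximizes_def by (intro cSup_eq_maximum) auto

lemma maximizes_value: "\<lbrakk>maximizes P u v; maximizes P u w\<rbrakk> \<Longrightarrow> u \<bullet> v = u \<bullet> w"
  unfolding maximizes_def by (meson order_antisym)

lemma maximizes_exists:
  assumes "compact P" "P \<noteq> {}"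
  obtains v where "maximizes P u v"
proof -
  have "continuous_on P (\<lambda>y. u \<bullet> y)"
    by (intro continuous_intros)
  from continuous_attains_sup[OF assms this] show ?thesis
    using that unfolding maximizes_def by blast
qed

lemma maximizes_Minkowski_sum:
  assumes "P \<noteq> {}" "Q \<noteq> {}"
  shows "maximizes (P + Q) u v \<longleftrightarrow> (\<exists>p q. v = p + q \<and> maximizes P u p \<and> maximizes Q u q)"
proof
  assume v: "maximizes (P + Q) u v"
  then obtain p q where pq: "v = p + q" "p \<in> P" "q \<in> Q"
    unfolding maximizes_def by (auto elim: set_plus_elim)
  have ineq: "u \<bullet> (p' + q') \<le> u \<bullet> (p + q)" if "p' \<in> P" "q' \<in> Q" for p' q'
    using v that pq(1) set_plus_intro unfolding maximizes_def by blast
  have "u \<bullet> y \<le> u \<bullet> p" if "y \<in> P" for y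
    using ineq[OF that pq(3)] by (simp add: inner_add_right)
  moreover have "u \<bullet> y \<le> u \<bullet> q" if "y \<in> Q" for y
    using ineq[OF pq(2) that] by (simp add: inner_add_right)
  ultimately show "\<exists>p q. v = p + q \<and> maximizes P u p \<and> maximizes Q u q"
    using pq unfolding maximizes_def by blast
next
  assume "\<exists>p q. v = p + q \<and> maximizes P u p \<and> maximizes Q u q"
  then show "maximizes (P + Q) u v"
    unfolding maximizes_def
    by (auto elim!: set_plus_elim simp: inner_add_right intro!: add_mono)
qed

text \<open>A maximiser over the sum splits into maximisers over the summands, so it is unique iff
  both of these are.\<close>

lemma kinks_Minkowski_sum:
  assumes "compact P" "P \<noteq> {}" "compact Q" "Q \<noteq> {}"
  shows "kinks (P + Q) = kinks P \<union> kinks Q"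
proof (intro equalityI subsetI)
  fix u assume "u \<in> kinks (P + Q)"
  then obtain v w where vw: "v \<noteq> w" "maximizes (P + Q) u v" "maximizes (P + Q) u w"
    unfolding kinks_def by blast
  then obtain p q p' q' where *: "v = p + q" "maximizes P u p" "maximizes Q u q"
    "w = p' + q'" "maximizes P u p'" "maximizes Q u q'"
    unfolding maximizes_Minkowski_sum[OF assms(2,4)] by blast
  with vw(1) have "p \<noteq> p' \<or> q \<noteq> q'" by blast
  with * show "u \<in> kinks P \<union> kinks Q" unfolding kinks_def by blast
next
  fix u assume u: "u \<in> kinks P \<union> kinks Q"
  obtain p0 where p0: "maximizes P u p0" using maximizes_exists assms by metis
  obtain q0 where q0: "maximizes Q u q0" using maximizes_exists assms by metis
  from u show "u \<in> kinks (P + Q)"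
  proof
    assume "u \<in> kinks P"
    then obtain p p' where p: "p \<noteq> p'" "maximizes P u p" "maximizes P u p'"
      unfolding kinks_def by blast
    then have "p + q0 \<noteq> p' + q0" "maximizes (P + Q) u (p + q0)" "maximizes (P + Q) u (p' + q0)"
      using q0 by (auto simp: maximizes_Minkowski_sum[OF assms(2,4)])
    then show ?thesis unfolding kinks_def by blast
  next
    assume "u \<in> kinks Q"
    then obtain p p' where p: "p \<noteq> p'" "maximizes Q u p" "maximizes Q u p'"
      unfolding kinks_def by blast
    then have "p0 + p \<noteq> p0 + p'" "maximizes (P + Q) u (p0 + p)" "maximizes (P + Q) u (p0 + p')"
      using p0 by (auto simp: maximizes_Minkowski_sum[OF assms(2,4)])
    then show ?thesis unfolding kinks_def by blast
  qed
qed

lemma supp_Minkowski_sum: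
  assumes "compact P" "P \<noteq> {}" "compact Q" "Q \<noteq> {}"
  shows "supp (P + Q) u = supp P u + supp Q u"
proof -
  obtain p where p: "maximizes P u p" using maximizes_exists assms by metis
  obtain q where q: "maximizes Q u q" using maximizes_exists assms by metis
  have "maximizes (P + Q) u (p + q)"
    using p q by (auto simp: maximizes_Minkowski_sum[OF assms(2,4)])
  with p q show ?thesis by (simp add: supp_eq inner_add_right)
qed

lemma kinks_scaleR:
  assumes "0 \<le> c"
  shows "kinks ((*\<^sub>R) c ` P) \<subseteq> kinks P"
proof (cases "c = 0")
  case True
  then show ?thesis unfolding kinks_def maximizes_def by auto
next
  case False
  then have c: "c > 0" using assms by simp
  have *: "maximizes P u v" if "maximizes ((*\<^sub>R) c ` P) u (c *\<^sub>R v)" "v \<in> P" for u v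
    using that c unfolding maximizes_def by auto
  show ?thesis
  proof
    fix u assume "u \<in> kinks ((*\<^sub>R) c ` P)"
    then obtain v w where vw: "v \<noteq> w" "maximizes ((*\<^sub>R) c ` P) u v" "maximizes ((*\<^sub>R) c ` P) u w"
      unfolding kinks_def by blast
    then obtain p q where "v = c *\<^sub>R p" "p \<in> P" "w = c *\<^sub>R q" "q \<in> P"
      unfolding maximizes_def by blast
    with vw * have "p \<noteq> q" "maximizes P u p" "maximizes P u q" by auto
    then show "u \<in> kinks P" unfolding kinks_def by blast
  qed
qed

lemma supp_scaleR:
  assumes "0 \<le> c" "compact P" "P \<noteq> {}"
  shows "supp ((*\<^sub>R) c ` P) u = c * supp P u"
proof -
  obtain p where p: "maximizes P u p" using maximizes_exists assms by metis
  then have "maximizes ((*\<^sub>R) c ` P) u (c *\<^sub>R p)"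
    using assms(1) unfolding maximizes_def by (auto intro: mult_left_mono)
  with p show ?thesis by (simp add: supp_eq)
qed

lemma maximizes_translation: "maximizes ((+) t ` P) u (t + v) \<longleftrightarrow> maximizes P u v"
  unfolding maximizes_def by (auto simp: inner_add_right)

lemma kinks_translation: "kinks ((+) t ` P) = kinks P"
proof -
  have "kinks ((+) t ` P) \<subseteq> kinks P" for t and P :: "'a set"
  proof
    fix u assume "u \<in> kinks ((+) t ` P)"
    then obtain v w where vw: "v \<noteq> w" "maximizes ((+) t ` P) u v" "maximizes ((+) t ` P) u w"
      unfolding kinks_def by blast
    then obtain p q where "v = t + p" "w = t + q" unfolding maximizes_def by blast
    with vw show "u \<in> kinks P" unfolding kinks_def by (auto simp: maximizes_translation)
  qed
  from this[of t P] this[of "- t" "(+) t ` P"] show ?thesis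
    by (auto simp: image_image)
qed

lemma supp_translation:
  assumes "compact P" "P \<noteq> {}"
  shows "supp ((+) t ` P) u = u \<bullet> t + supp P u"
proof -
  obtain p where p: "maximizes P u p" using maximizes_exists assms by metis
  then have "maximizes ((+) t ` P) u (t + p)" by (simp add: maximizes_translation)
  with p show ?thesis by (simp add: supp_eq inner_add_right)
qed

lemma maximizes_convex_hull:
  assumes "v \<in> V" "\<And>y. y \<in> V \<Longrightarrow> u \<bullet> y \<le> u \<bullet> v"
  shows "maximizes (convex hull V) u v"
proof -
  have "convex hull V \<subseteq> {y. u \<bullet> y \<le> u \<bullet> v}"
    using assms(2) by (intro hull_minimal) (auto simp: convex_halfspace_le)
  then show ?thesis using assms(1) by (auto simp: maximizes_def hull_inc)
qed

text \<open>The maximisers form a face, which is the hull of some points of \<open>V\<close>; a face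
  with two points has two distinct generators. Kinks of shard polytopes are thereby witnessed by two
  matchings.\<close>

lemma kinks_convex_hullE:
  fixes V :: "'a::euclidean_space set"
  assumes "finite V" "u \<in> kinks (convex hull V)"
  obtains v w where "v \<in> V" "w \<in> V" "v \<noteq> w" "maximizes (convex hull V) u v"
    "maximizes (convex hull V) u w"
proof -
  let ?P = "convex hull V"
  obtain v w where vw: "v \<noteq> w" "maximizes ?P u v" "maximizes ?P u w"
    using assms(2) unfolding kinks_def by blast
  define T where "T = ?P \<inter> {y. u \<bullet> y = u \<bullet> v}"
  have T: "T face_of ?P"
    unfolding T_def using vw(2) unfolding maximizes_def
    by (intro face_of_Int_supporting_hyperplane_le) auto
  then obtain V' where V': "V' \<subseteq> V" "T = convex hull V'"
    using face_of_convex_hull_subset[of V T] assms(1) finite_imp_compact by blast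
  have "v \<in> T" "w \<in> T"
    using vw maximizes_value[OF vw(2,3)] unfolding T_def maximizes_def by auto
  then have "\<not> (\<exists>z. V' \<subseteq> {z})"
    using vw(1) V'(2) by (metis convex_hull_empty convex_hull_singleton empty_iff
        singletonD subset_singletonD)
  then obtain p q where pq: "p \<in> V'" "q \<in> V'" "p \<noteq> q" by blast
  then have "p \<in> T" "q \<in> T" using V'(2) by (auto simp: hull_inc)
  then have "maximizes ?P u p" "maximizes ?P u q"
    using vw(2) unfolding T_def maximizes_def by auto
  with pq V'(1) that show ?thesis by blast
qed

text \<open>The sets of directions in which one point of \<open>V\<close> strictly beats all others
  are open and disjoint, and in the absence of kinks they cover \<open>W\<close>; connectedness
  leaves a single one. The weak inequalities survive in the closure.\<close>

lemma connected_common_maximizer: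
  fixes P :: "'a::euclidean_space set"
  assumes "polytope P" "P \<noteq> {}" "connected W" "W \<inter> kinks P = {}"
  obtains v where "v \<in> P" "\<And>y. y \<in> closure W \<Longrightarrow> maximizes P y v"
proof (cases "W = {}")
  case True
  with assms(2) that show ?thesis by auto
next
  case False
  obtain V where V: "finite V" "P = convex hull V"
    using assms(1) unfolding polytope_def by blast
  have "V \<noteq> {}" using V(2) assms(2) by auto
  define Op where "Op v = {y. \<forall>w\<in>V - {v}. y \<bullet> w < y \<bullet> v}" for v
  have op: "open (Op v)" for v
  proof -
    have "Op v = (\<Inter>w\<in>V - {v}. {y. y \<bullet> w < y \<bullet> v})" unfolding Op_def by auto
    moreover have "open {y. y \<bullet> w < y \<bullet> v}" for w
      by (intro open_Collect_less continuous_intros)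
    ultimately show ?thesis using V(1) by (auto intro: open_INT)
  qed
  have disj: "Op v \<inter> Op w = {}" if "v \<in> V" "w \<in> V" "v \<noteq> w" for v w
  proof -
    have "\<not> (y \<in> Op v \<and> y \<in> Op w)" for y
    proof
      assume "y \<in> Op v \<and> y \<in> Op w"
      then have "y \<bullet> w < y \<bullet> v" "y \<bullet> v < y \<bullet> w" using that unfolding Op_def by auto
      then show False by simp
    qed
    then show ?thesis by blast
  qed
  have cov: "\<exists>v\<in>V. y \<in> Op v" if yW: "y \<in> W" for y
  proof -
    have fin: "finite ((\<bullet>) y ` V)" "(\<bullet>) y ` V \<noteq> {}" using V(1) \<open>V \<noteq> {}\<close> by auto
    then obtain v where v: "v \<in> V" "y \<bullet> v = Max ((\<bullet>) y ` V)"
      using Max_in by (metis (no_types, lifting) imageE)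
    then have le: "y \<bullet> w \<le> y \<bullet> v" if "w \<in> V" for w
      using fin(1) that by simp
    have vm: "maximizes P y v"
      unfolding V(2) using v(1) le by (rule maximizes_convex_hull)
    have "y \<bullet> w < y \<bullet> v" if w: "w \<in> V - {v}" for w
    proof (rule ccontr)
      assume "\<not> ?thesis"
      then have "y \<bullet> w = y \<bullet> v" using le w by fastforce
      then have "maximizes P y w"
        unfolding V(2) using w le by (intro maximizes_convex_hull) auto
      then have "y \<in> kinks P" using vm w unfolding kinks_def by blast
      with yW have "y \<in> W \<inter> kinks P" by (rule IntI)
      then show False unfolding assms(4) by (rule emptyE)
    qed
    then show ?thesis using v(1) unfolding Op_def by blast
  qed
  obtain y0 v where v: "y0 \<in> W" "v \<in> V" "y0 \<in> Op v" using False cov by blast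
  let ?O = "\<Union>w\<in>V - {v}. Op w"
  have "Op v \<inter> W = {} \<or> ?O \<inter> W = {}"
  proof (rule connectedD[OF assms(3)])
    show "open (Op v)" "open ?O" using op by auto
    show "Op v \<inter> ?O \<inter> W = {}" using disj v(2) by blast
    show "W \<subseteq> Op v \<union> ?O" using cov by blast
  qed
  then have "W \<subseteq> Op v" using v cov by blast
  have "closure W \<subseteq> {y. \<forall>w\<in>V. y \<bullet> w \<le> y \<bullet> v}"
  proof (rule closure_minimal)
    show "W \<subseteq> {y. \<forall>w\<in>V. y \<bullet> w \<le> y \<bullet> v}"
    proof (clarify)
      fix y w assume "y \<in> W" "w \<in> V"
      with \<open>W \<subseteq> Op v\<close> have "w \<noteq> v \<longrightarrow> y \<bullet> w < y \<bullet> v" unfolding Op_def by auto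
      then show "y \<bullet> w \<le> y \<bullet> v" by (cases "w = v") auto
    qed
    have "{y. \<forall>w\<in>V. y \<bullet> w \<le> y \<bullet> v} = (\<Inter>w\<in>V. {y. y \<bullet> w \<le> y \<bullet> v})" by auto
    moreover have "closed {y. y \<bullet> w \<le> y \<bullet> v}" for w
      by (intro closed_Collect_le continuous_intros)
    ultimately show "closed {y. \<forall>w\<in>V. y \<bullet> w \<le> y \<bullet> v}" by auto
  qed
  then have "maximizes P y v" if "y \<in> closure W" for y
    unfolding V(2) using that v(2) by (intro maximizes_convex_hull) auto
  moreover have "v \<in> P" unfolding V(2) using v(2) by (rule hull_inc)
  ultimately show ?thesis using that by blast
qed

text \<open>A point of one set outside the other can be strictly separated from the latter; in the
  separating direction the two maxima differ, so no maximiser is common.\<close>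

lemma compact_convex_eq_if_common_maximizers:
  fixes P Q :: "'a::euclidean_space set"
  assumes "compact P" "convex P" "compact Q" "convex Q"
    and common: "\<And>u. \<exists>v. maximizes P u v \<and> maximizes Q u v"
  shows "P = Q"
proof -
  have sub: "P \<subseteq> Q" if Q: "compact Q" "convex Q"
    and common: "\<And>u. \<exists>v. maximizes P u v \<and> maximizes Q u v" for P Q :: "'a set"
  proof (rule ccontr)
    assume "\<not> P \<subseteq> Q"
    then obtain p where p: "p \<in> P" "p \<notin> Q" by blast
    obtain a b where ab: "a \<bullet> p < b" "\<forall>x\<in>Q. a \<bullet> x > b"
      using separating_hyperplane_closed_point[OF Q(2) compact_imp_closed[OF Q(1)] p(2)] by blast
    obtain v where v: "maximizes P (- a) v" "maximizes Q (- a) v" using common by blast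
    then have "v \<in> Q" "- a \<bullet> p \<le> - a \<bullet> v" using p unfolding maximizes_def by auto
    with ab show False by fastforce
  qed
  show ?thesis
  proof
    show "P \<subseteq> Q" by (rule sub[OF assms(3,4) common])
    have "\<exists>v. maximizes Q u v \<and> maximizes P u v" for u using common[of u] by blast
    then show "Q \<subseteq> P" by (rule sub[OF assms(1,2)])
  qed
qed

section \<open>Mixed differences of set functions\<close>

text \<open>The negative of the usual second difference, so that submodular functions get
  nonnegative values for distinct \<open>c\<close>, \<open>d\<close> outside
  \<open>S\<close>.\<close>

definition mixed_difference :: "('n set \<Rightarrow> real) \<Rightarrow> 'n \<Rightarrow> 'n \<Rightarrow> 'n set \<Rightarrow> real" where
  "mixed_difference G c d S = G (insert c S) + G (insert d S) - G S - G (insert c (insert d S))"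

lemma mixed_difference_commute: "mixed_difference G c d S = mixed_difference G d c S"
  by (simp add: mixed_difference_def insert_commute)

lemma mixed_difference_third:
  "mixed_difference G c d (insert e S) - mixed_difference G c d S
     = mixed_difference G c e (insert d S) - mixed_difference G c e S"
  by (simp add: mixed_difference_def insert_commute)

lemma modular_if_mixed_difference_zero:
  fixes G :: "'n::finite set \<Rightarrow> real"
  assumes "\<And>c d S. \<lbrakk>c \<noteq> d; c \<notin> S; d \<notin> S\<rbrakk> \<Longrightarrow> mixed_difference G c d S = 0"
  shows "G S = G {} + (\<Sum>i\<in>S. G {i} - G {})"
proof -
  have *: "G (insert c S) - G S = G {c} - G {}" if "finite S" "c \<notin> S" for c S
    using that
  proof (induction S rule: finite_induct)
    case (insert d S)
    then have "mixed_difference G c d S = 0" using assms by auto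
    with insert show ?case by (simp add: mixed_difference_def)
  qed simp
  have "finite S" by simp
  then show ?thesis
  proof (induction S rule: finite_induct)
    case (insert c S)
    with *[of S c] show ?case by (simp add: algebra_simps)
  qed simp
qed

lemma mixed_difference_determined:
  fixes G :: "'n::finite set \<Rightarrow> real"
  assumes "c \<notin> R" "d \<notin> R" "E \<inter> R = {}" "c \<notin> E" "d \<notin> E"
    and step: "\<And>e S. \<lbrakk>e \<in> E; e \<notin> S; c \<notin> S; d \<notin> S\<rbrakk> \<Longrightarrow>
      mixed_difference G c d (insert e S) = mixed_difference G c d S"
  shows "mixed_difference G c d (E \<union> R) = mixed_difference G c d R"
proof -
  have "finite E" by simp
  have "mixed_difference G c d (E' \<union> R) = mixed_difference G c d R" if "finite E'" "E' \<subseteq> E" for E'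
    using that
  proof (induction E' rule: finite_induct)
    case (insert e E')
    have "mixed_difference G c d (insert e (E' \<union> R)) = mixed_difference G c d (E' \<union> R)"
      using insert assms by (intro step) auto
    with insert show ?case by simp
  qed simp
  from this[OF \<open>finite E\<close>] show ?thesis by simp
qed

section \<open>Critical sets and the vanishing of mixed differences\<close>

locale arc_data =
  fixes a b :: "'n::{finite,linorder}" and A B :: "'n set"
  assumes less: "a < b" and cover: "A \<union> B = {a<..<b}" and disjoint: "A \<inter> B = {}"
begin

text \<open>The part between \<open>c\<close> and \<open>d\<close> is the only trace for which the
  wall can carry a kink. Outside, everything beyond an endpoint is taken if that endpoint is in
  \<open>A\<close>, and nothing otherwise; this makes strictly longer arcs contribute 0. For three
  indices with 2 in \<open>B\<close>, putting 1 into the set of (2, 3) would give the shard polytope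
  of (1, 3) the value 1.\<close>

definition critical_set :: "'n \<Rightarrow> 'n \<Rightarrow> 'n set" where
  "critical_set c d = B \<inter> {c<..<d} \<union> (if c \<in> A then {..<c} else {}) \<union> (if d \<in> A then {d<..} else {})"

lemma critical_set_middle: "c < d \<Longrightarrow> critical_set c d \<inter> {c<..<d} = B \<inter> {c<..<d}"
  by (auto simp: critical_set_def)

lemma critical_set_ends: "c < d \<Longrightarrow> c \<notin> critical_set c d \<and> d \<notin> critical_set c d"
  by (auto simp: critical_set_def)

text \<open>
  By induction from long intervals to short ones: by the symmetry of third differences, changing
  \<open>S\<close> at an index \<open>e\<close> outside \<open>[c, d]\<close> changes the mixed difference at \<open>(c, d)\<close> by mixed
  differences at a longer interval with endpoint \<open>e\<close>.
\<close>

lemma mixed_difference_zero: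
  assumes vanish: "\<And>c d S. \<lbrakk>c < d; c \<notin> S; d \<notin> S;
      \<not> (a \<le> c \<and> d \<le> b \<and> S \<inter> {c<..<d} = B \<inter> {c<..<d})\<rbrakk> \<Longrightarrow> mixed_difference G c d S = 0"
    and critical: "\<And>c d. \<lbrakk>a \<le> c; c < d; d \<le> b\<rbrakk> \<Longrightarrow> mixed_difference G c d (critical_set c d) = 0"
    and "c < d" "c \<notin> S" "d \<notin> S"
  shows "mixed_difference G c d S = 0"
  using assms(3-)
proof (induction "card (- {c..d})" arbitrary: c d S rule: less_induct)
  case less
  have step: "mixed_difference G c d (insert e T) = mixed_difference G c d T"
    if T: "e \<in> - {c..d}" "e \<notin> T" "c \<notin> T" "d \<notin> T" for e T
  proof (cases "e < c")
    case True
    have "- {e..d} \<subset> - {c..d}" using True \<open>c < d\<close> by (force simp: not_le)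
    then have "card (- {e..d}) < card (- {c..d})" by (intro psubset_card_mono) auto
    then have "mixed_difference G e d T' = 0" if "e \<notin> T'" "d \<notin> T'" for T'
      using less.hyps that True \<open>c < d\<close> by auto
    then have "mixed_difference G d e (insert c T) = 0" "mixed_difference G d e T = 0"
      using T True \<open>c < d\<close> by (auto simp: mixed_difference_commute[of G d e])
    \<comment> \<open>The third difference in \<open>d\<close>, \<open>c\<close>, \<open>e\<close>
      is read along the pair \<open>d\<close>, \<open>e\<close>, whose interval [e, d] is
      longer.\<close>
    with mixed_difference_third[of G d c e T] show ?thesis
      by (simp add: mixed_difference_commute[of G d c])
  next
    case False
    then have "d < e" using T by auto
    have "- {c..e} \<subset> - {c..d}" using \<open>d < e\<close> \<open>c < d\<close> by (force simp: not_le)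
    then have "card (- {c..e}) < card (- {c..d})" by (intro psubset_card_mono) auto
    then have "mixed_difference G c e T' = 0" if "c \<notin> T'" "e \<notin> T'" for T'
      using less.hyps that \<open>d < e\<close> \<open>c < d\<close> by auto
    then have "mixed_difference G c e (insert d T) = 0" "mixed_difference G c e T = 0"
      using T \<open>d < e\<close> \<open>c < d\<close> by auto
    with mixed_difference_third[of G c d e T] show ?thesis by simp
  qed
  \<comment> \<open>By \<open>step\<close> the indices outside [c, d] can be removed one by one, so
    sets with the same trace between \<open>c\<close> and \<open>d\<close> have the same
    value.\<close>
  have middle: "mixed_difference G c d T = mixed_difference G c d (T \<inter> {c<..<d})"
    if "c \<notin> T" "d \<notin> T" for T
  proof -
    have "T = (T - {c..d}) \<union> (T \<inter> {c<..<d})"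
      using that by (auto simp: order_le_less)
    moreover have "mixed_difference G c d ((T - {c..d}) \<union> (T \<inter> {c<..<d}))
        = mixed_difference G c d (T \<inter> {c<..<d})"
      using \<open>c < d\<close> by (intro mixed_difference_determined step) auto
    ultimately show ?thesis by simp
  qed
  show ?case
  proof (cases "a \<le> c \<and> d \<le> b \<and> S \<inter> {c<..<d} = B \<inter> {c<..<d}")
    case True
    then have "mixed_difference G c d S = mixed_difference G c d (critical_set c d)"
      using middle[of S] middle[of "critical_set c d"] less.prems critical_set_ends critical_set_middle
      by simp
    then show ?thesis using critical True less.prems by simp
  next
    case False
    then show ?thesis using vanish less.prems by blast
  qed
qed

end

section \<open>Alternating vectors\<close>

definition prefix_sum :: "real ^ 'n::{finite,linorder} \<Rightarrow> 'n \<Rightarrow> real" where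
  "prefix_sum y k = (\<Sum>i\<le>k. y $ i)"

text \<open>Characteristic vectors of matchings, described without pairs: prefix sums in {0, 1} say
  that the nonzero entries alternate between 1 and -1 beginning with 1, and total 0 says that the
  last pair is closed. Exchanging matchings becomes shifting prefix sums on an interval.\<close>

definition alternating_vectors :: "'n::{finite,linorder} set \<Rightarrow> 'n set \<Rightarrow> (real ^ 'n::{finite,linorder}) set" where
  "alternating_vectors X Z = {y. (\<forall>i. 0 < y $ i \<longrightarrow> i \<in> X) \<and> (\<forall>i. y $ i < 0 \<longrightarrow> i \<in> Z) \<and>
     (\<Sum>i\<in>UNIV. y $ i) = 0 \<and> (\<forall>k. prefix_sum y k \<in> {0, 1})}"

lemma prefix_sum_add [simp]: "prefix_sum (x + y) k = prefix_sum x k + prefix_sum y k"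
  by (simp add: prefix_sum_def sum.distrib)

lemma prefix_sum_diff [simp]: "prefix_sum (x - y) k = prefix_sum x k - prefix_sum y k"
  by (simp add: prefix_sum_def sum_subtractf)

lemma prefix_sum_zero [simp]: "prefix_sum 0 k = 0"
  by (simp add: prefix_sum_def)

lemma prefix_sum_axis [simp]: "prefix_sum (axis p 1) k = (if p \<le> k then 1 else 0)"
  by (simp add: prefix_sum_def axis_def)

lemma sum_axis [simp]: "(\<Sum>i\<in>UNIV. axis p (1::real) $ i) = 1"
  by (simp add: axis_def)

lemma axis_nth_if: "axis p x $ i = (if i = p then x else 0)"
  by (simp add: axis_def)

lemma characteristic_vector_simps [simp]:
  "characteristic_vector [] = 0"
  "characteristic_vector ((p, q) # M) = axis p 1 - axis q 1 + characteristic_vector M"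
  by (simp_all add: characteristic_vector_def)

lemma characteristic_vector_pos: "0 < characteristic_vector M $ i \<Longrightarrow> i \<in> fst ` set M"
  by (induction M) (auto simp: axis_nth_if split: if_splits)

lemma characteristic_vector_neg: "characteristic_vector M $ i < 0 \<Longrightarrow> i \<in> snd ` set M"
  by (induction M) (auto simp: axis_nth_if split: if_splits)

abbreviation matching_sequence :: "('n \<times> 'n) list \<Rightarrow> 'n list" where
  "matching_sequence M \<equiv> concat (map (\<lambda>(p, q). [p, q]) M)"

lemma set_matching_sequence: "set (matching_sequence M) = fst ` set M \<union> snd ` set M"
  by (induction M) auto

lemma characteristic_vector_outside:
  "i \<notin> set (matching_sequence M) \<Longrightarrow> characteristic_vector M $ i = 0"
  unfolding set_matching_sequence using characteristic_vector_pos[of M i] characteristic_vector_neg[of M i]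
  by (cases "characteristic_vector M $ i" "0::real" rule: linorder_cases) auto

lemma characteristic_vector_alternating:
  assumes "sorted_wrt (<) (matching_sequence M)" "fst ` set M \<subseteq> X" "snd ` set M \<subseteq> Z"
  shows "characteristic_vector M \<in> alternating_vectors X Z"
proof -
  have "(\<Sum>i\<in>UNIV. characteristic_vector M $ i) = 0"
    by (induction M) (auto simp: sum.distrib sum_subtractf)
  moreover have "prefix_sum (characteristic_vector M) k \<in> {0, 1}" for k
    using assms(1)
  proof (induction M)
    case (Cons pq M)
    obtain p q where pq: "pq = (p, q)" by fastforce
    have sorted: "p < q" "sorted_wrt (<) (matching_sequence M)" "\<And>i. i \<in> set (matching_sequence M) \<Longrightarrow> q < i"
      using Cons.prems unfolding pq by auto
    show ?case
    \<comment> \<open>Before \<open>q\<close> only the entry at \<open>p\<close> can count, since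
      the remaining matching starts after \<open>q\<close>; from \<open>q\<close> on the first pair
      cancels.\<close>
    proof (cases "k < q")
      case True
      have "characteristic_vector M $ i = 0" if "i \<le> k" for i
      proof (rule characteristic_vector_outside, rule notI)
        assume "i \<in> set (matching_sequence M)"
        with sorted(3) have "q < i" by blast
        with that True show False by order
      qed
      then have "prefix_sum (characteristic_vector M) k = 0"
        by (simp add: prefix_sum_def)
      with True show ?thesis by (auto simp: pq)
    next
      case False
      with Cons.IH sorted show ?thesis by (auto simp: pq)
    qed
  qed simp
  moreover have "0 < characteristic_vector M $ i \<longrightarrow> i \<in> X" "characteristic_vector M $ i < 0 \<longrightarrow> i \<in> Z" for i
    using assms(2,3) characteristic_vector_pos[of M i] characteristic_vector_neg[of M i] by auto
  ultimately show ?thesis unfolding alternating_vectors_def by simp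
qed

lemma prefix_sum_eq_zero_below:
  assumes "\<And>i. i < j \<Longrightarrow> y $ i = 0"
  shows "prefix_sum y j = y $ j"
proof -
  have "prefix_sum y j = (\<Sum>i\<in>{j}. y $ i)"
    unfolding prefix_sum_def using assms by (intro sum.mono_neutral_right) (auto simp: order_le_less)
  then show ?thesis by simp
qed

text \<open>Read from the left, the first nonzero entry must be 1 and the next one -1, as no other
  values keep the prefix sums in {0, 1}. Removing this pair leaves a vector of the same kind with
  fewer nonzero entries.\<close>

lemma alternating_vector_matching:
  assumes "y \<in> alternating_vectors X Z"
  obtains M where "sorted_wrt (<) (matching_sequence M)" "fst ` set M \<subseteq> X" "snd ` set M \<subseteq> Z"
    "characteristic_vector M = y"
proof -
  \<comment> \<open>The last clause strengthens the induction: the matching of the remainder uses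
    only indices with nonzero entries, hence only indices after the removed pair.\<close>
  have "\<exists>M. sorted_wrt (<) (matching_sequence M) \<and> fst ` set M \<subseteq> X \<and> snd ` set M \<subseteq> Z \<and>
      characteristic_vector M = y \<and> (\<forall>i\<in>set (matching_sequence M). y $ i \<noteq> 0)"
    using assms
  proof (induction "card {i. y $ i \<noteq> 0}" arbitrary: y rule: less_induct)
    case less
    have y: "\<And>i. 0 < y $ i \<Longrightarrow> i \<in> X" "\<And>i. y $ i < 0 \<Longrightarrow> i \<in> Z" "(\<Sum>i\<in>UNIV. y $ i) = 0"
      "\<And>k. prefix_sum y k = 0 \<or> prefix_sum y k = 1"
      using less.prems unfolding alternating_vectors_def by auto
    show ?case
    proof (cases "y = 0")
      case True
      then show ?thesis by (intro exI[of _ "[]"]) auto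
    next
      case False
      define j where "j = Min {i. y $ i \<noteq> 0}"
      have "{i. y $ i \<noteq> 0} \<noteq> {}" using False by (auto simp: vec_eq_iff)
      then have j: "y $ j \<noteq> 0" "\<And>i. i < j \<Longrightarrow> y $ i = 0"
        using Min_in[of "{i. y $ i \<noteq> 0}"] Min_le[of "{i. y $ i \<noteq> 0}"]
        unfolding j_def by (auto simp: leD)
      have "prefix_sum y j = y $ j" using j(2) by (rule prefix_sum_eq_zero_below)
      then have yj: "y $ j = 1" using j(1) y(4)[of j] by auto
      let ?K = "{i. j < i \<and> y $ i \<noteq> 0}"
      define k where "k = Min ?K"
      have "?K \<noteq> {}"
      proof
        assume "?K = {}"
        then have "y $ i = 0" if "i \<noteq> j" for i
          using that j(2)[of i] by (cases "i < j") auto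
        then have "(\<Sum>i\<in>UNIV. y $ i) = (\<Sum>i\<in>{j}. y $ i)"
          by (intro sum.mono_neutral_right) auto
        then show False using y(3) yj by simp
      qed
      then have k: "j < k" "y $ k \<noteq> 0" "\<And>i. \<lbrakk>j < i; i < k\<rbrakk> \<Longrightarrow> y $ i = 0"
        using Min_in[of ?K] Min_le[of ?K] unfolding k_def by (auto simp: leD)
      define y' where "y' = y - (axis j 1 - axis k 1)"
      have y'_nth: "y' $ i = y $ i - (if i = j then 1 else 0) + (if i = k then 1 else 0)" for i
        by (simp add: y'_def axis_nth_if)
      have below: "y' $ i = 0" if "i < k" for i
        using that j(2)[of i] k(3)[of i] yj by (cases "i < j"; cases "i = j") (auto simp: y'_nth)
      have "prefix_sum y' k = y' $ k" using below by (rule prefix_sum_eq_zero_below)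
      then have "y $ k + 1 = prefix_sum y k" using k(1) by (simp add: y'_nth y'_def axis_nth_if less_imp_le split: if_splits)
      then have yk: "y $ k = - 1" using k(2) y(4)[of k] by auto
      have "y' \<in> alternating_vectors X Z"
      proof -
        have "prefix_sum y' i \<in> {0, 1}" for i
        proof (cases "i < k")
          case True
          then have "prefix_sum y' i = 0" using below by (simp add: prefix_sum_def)
          then show ?thesis by simp
        next
          case False
          then have "k \<le> i" "j \<le> i" using k(1) by order+
          then have "prefix_sum y' i = prefix_sum y i" by (simp add: y'_def)
          then show ?thesis using y(4)[of i] by auto
        qed
        moreover have "(\<Sum>i\<in>UNIV. y' $ i) = 0"
          using y(3) by (simp add: y'_def sum_subtractf)
        moreover have "0 < y' $ i \<longrightarrow> i \<in> X" "y' $ i < 0 \<longrightarrow> i \<in> Z" for i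
          using y(1,2)[of i] yj yk k(1) by (auto simp: y'_nth split: if_splits)
        ultimately show ?thesis unfolding alternating_vectors_def by blast
      qed
      moreover have "card {i. y' $ i \<noteq> 0} < card {i. y $ i \<noteq> 0}"
      proof (rule psubset_card_mono)
        have "y' $ i = 0" if "y $ i = 0" for i
          using that yj yk by (auto simp: y'_nth)
        moreover have "y' $ j = 0" using k(1) below by blast
        ultimately show "{i. y' $ i \<noteq> 0} \<subset> {i. y $ i \<noteq> 0}"
          using j(1) by blast
      qed simp
      ultimately obtain M where M: "sorted_wrt (<) (matching_sequence M)" "fst ` set M \<subseteq> X"
        "snd ` set M \<subseteq> Z" "characteristic_vector M = y'" "\<forall>i\<in>set (matching_sequence M). y' $ i \<noteq> 0"
        using less.hyps by blast
      have y'k: "y' $ k = 0" using yk k(1) by (simp add: y'_nth)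
      have later: "k < i" if "i \<in> set (matching_sequence M)" for i
      proof -
        have "y' $ i \<noteq> 0" using M(5) that by (rule bspec)
        with below[of i] y'k show ?thesis by (metis linorder_neqE)
      qed
      then have "sorted_wrt (<) (matching_sequence ((j, k) # M))"
        using M(1) k(1) by (simp del: set_concat) (metis order.strict_trans)
      moreover have "j \<in> X" "k \<in> Z" using y(1)[of j] y(2)[of k] yj yk by auto
      moreover have "\<forall>i\<in>set (matching_sequence ((j, k) # M)). y $ i \<noteq> 0"
      proof
        fix i assume "i \<in> set (matching_sequence ((j, k) # M))"
        then consider "i = j" | "i = k" | "i \<in> set (matching_sequence M)" by (auto simp del: set_concat)
        then show "y $ i \<noteq> 0"
        proof cases
          case 3
          then have "y' $ i \<noteq> 0" "k < i" using M(5) later by blast+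
          with k(1) show ?thesis by (auto simp: y'_nth split: if_splits)
        qed (use yj yk in auto)
      qed
      moreover have "characteristic_vector ((j, k) # M) = y" using M(4) by (simp add: y'_def)
      ultimately show ?thesis
        using M(2,3) by (intro exI[of _ "(j, k) # M"]) auto
    qed
  qed
  then show ?thesis using that by blast
qed

lemma alternating_vectors_eq:
  "alternating_vectors X Z = characteristic_vector `
     {M. sorted_wrt (<) (matching_sequence M) \<and> fst ` set M \<subseteq> X \<and> snd ` set M \<subseteq> Z}"
proof (intro equalityI subsetI)
  fix y assume "y \<in> alternating_vectors X Z"
  from alternating_vector_matching[OF this] show "y \<in> characteristic_vector ` {M.
      sorted_wrt (<) (matching_sequence M) \<and> fst ` set M \<subseteq> X \<and> snd ` set M \<subseteq> Z}"
    by (metis (mono_tags, lifting) image_eqI mem_Collect_eq)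
qed (auto simp: characteristic_vector_alternating)

lemma finite_alternating_vectors: "finite (alternating_vectors X Z)"
proof -
  let ?S = "{M :: ('a \<times> 'a) list. sorted_wrt (<) (matching_sequence M)}"
  have "distinct M" if "sorted_wrt (<) (matching_sequence M)" for M :: "('a \<times> 'a) list"
    using that by (induction M) (auto, force)
  then have "?S \<subseteq> {M. set M \<subseteq> UNIV \<and> distinct M}" by blast
  then have "finite ?S" by (rule finite_subset) (rule finite_subset_distinct, simp)
  then have "finite {M. sorted_wrt (<) (matching_sequence M) \<and> fst ` set M \<subseteq> X \<and> snd ` set M \<subseteq> Z}"
    by (rule rev_finite_subset) blast
  then show ?thesis unfolding alternating_vectors_eq by (rule finite_imageI)
qed

lemma shard_polytope_eq:
  fixes p q :: "'n::{finite,linorder}"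
  assumes "p < q" "A' \<union> B' = {p<..<q}"
  shows "shard_polytope (p, q, A', B') = convex hull (alternating_vectors (insert p A') (insert q B'))"
proof -
  have "i \<in> A' \<union> B' \<Longrightarrow> p < i \<and> i < q" for i using assms(2) by auto
  then have *: "i \<in> A' \<Longrightarrow> p \<le> i \<and> i \<le> q" "i \<in> B' \<Longrightarrow> p \<le> i \<and> i \<le> q" for i
    by (simp_all add: less_imp_le)
  have "alternating_matching (p, q, A', B') M \<longleftrightarrow>
    sorted_wrt (<) (matching_sequence M) \<and> fst ` set M \<subseteq> insert p A' \<and> snd ` set M \<subseteq> insert q B'" for M
    using assms(1) by (auto simp: less_imp_le dest: * split: prod.splits) (force dest: *)+
  then show ?thesis unfolding shard_polytope_def alternating_vectors_eq by presburger
qed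

text \<open>\<open>Max {..<i}\<close> is the predecessor of \<open>i\<close>; the index type has an
  order but no arithmetic.\<close>

lemma prefix_sum_step:
  assumes "j < i"
  shows "prefix_sum y i = prefix_sum y (Max {..<i}) + y $ i"
proof -
  have ne: "finite {..<i}" "{..<i} \<noteq> {}" using assms by auto
  have "{..i} = insert i {..Max {..<i}}"
  proof (intro equalityI subsetI)
    fix k assume "k \<in> {..i}"
    then show "k \<in> insert i {..Max {..<i}}" using Max_ge[OF ne(1)] by (auto simp: order_le_less)
  next
    fix k assume "k \<in> insert i {..Max {..<i}}"
    then show "k \<in> {..i}" using Max_in[OF ne] by auto
  qed
  moreover have "i \<notin> {..Max {..<i}}" using Max_in[OF ne] by auto
  ultimately show ?thesis by (simp add: prefix_sum_def)
qed

lemma prefix_sum_after_constant: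
  assumes const: "\<And>i. \<lbrakk>j \<le> i; i < k\<rbrakk> \<Longrightarrow> prefix_sum y i = s" and "j < i" "i \<le> k"
  shows "prefix_sum y i = s + y $ i"
proof -
  have "Max {..<i} \<in> {..<i}" using assms(2) by (intro Max_in) auto
  moreover have "j \<le> Max {..<i}" using assms(2) by (intro Max_ge) auto
  ultimately have "prefix_sum y (Max {..<i}) = s" using assms(3) by (intro const) auto
  with prefix_sum_step[OF assms(2), of y] show ?thesis by simp
qed

text \<open>The prefix sums rise from 0 to 1 from \<open>j\<close> up to but excluding
  \<open>k\<close> and stay fixed elsewhere, so only the signs of the two changed entries remain to
  be checked.\<close>

lemma alternating_vectors_add:
  assumes y: "y \<in> alternating_vectors X Z" and "j < k"
    and "\<And>i. \<lbrakk>j \<le> i; i < k\<rbrakk> \<Longrightarrow> prefix_sum y i = 0"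
    and "0 < y $ j + 1 \<Longrightarrow> j \<in> X" and "y $ k - 1 < 0 \<Longrightarrow> k \<in> Z"
  shows "y + (axis j 1 - axis k 1) \<in> alternating_vectors X Z"
proof -
  let ?y = "y + (axis j 1 - axis k 1)"
  have nth: "?y $ i = y $ i + (if i = j then 1 else 0) - (if i = k then 1 else 0)" for i
    by (simp add: axis_nth_if)
  have "prefix_sum ?y i \<in> {0, 1}" for i
  proof (cases "j \<le> i \<and> i < k")
    case True
    then have "prefix_sum y i = 0" using assms(3) by blast
    with True show ?thesis by (simp add: leD)
  next
    case False
    then have "prefix_sum ?y i = prefix_sum y i" using \<open>j < k\<close> by (auto simp: not_less)
    then show ?thesis using y unfolding alternating_vectors_def by auto
  qed
  moreover have "(\<Sum>i\<in>UNIV. ?y $ i) = 0"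
    using y by (simp add: alternating_vectors_def sum.distrib sum_subtractf)
  moreover have "0 < ?y $ i \<longrightarrow> i \<in> X" "?y $ i < 0 \<longrightarrow> i \<in> Z" for i
    using y assms(2,4,5) unfolding nth alternating_vectors_def
    by (cases "i = j"; cases "i = k"; force)+
  ultimately show ?thesis unfolding alternating_vectors_def by blast
qed

lemma alternating_vectors_diff:
  assumes y: "y \<in> alternating_vectors X Z" and "j < k"
    and "\<And>i. \<lbrakk>j \<le> i; i < k\<rbrakk> \<Longrightarrow> prefix_sum y i = 1"
    and "y $ j - 1 < 0 \<Longrightarrow> j \<in> Z" and "0 < y $ k + 1 \<Longrightarrow> k \<in> X"
  shows "y - (axis j 1 - axis k 1) \<in> alternating_vectors X Z"
proof -
  let ?y = "y - (axis j 1 - axis k 1)"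
  have nth: "?y $ i = y $ i - (if i = j then 1 else 0) + (if i = k then 1 else 0)" for i
    by (simp add: axis_nth_if)
  have "prefix_sum ?y i \<in> {0, 1}" for i
  proof (cases "j \<le> i \<and> i < k")
    case True
    then have "prefix_sum y i = 1" using assms(3) by blast
    with True show ?thesis by (simp add: leD)
  next
    case False
    then have "prefix_sum ?y i = prefix_sum y i" using \<open>j < k\<close> by (auto simp: not_less)
    then show ?thesis using y unfolding alternating_vectors_def by auto
  qed
  moreover have "(\<Sum>i\<in>UNIV. ?y $ i) = 0"
    using y by (simp add: alternating_vectors_def sum_subtractf)
  moreover have "0 < ?y $ i \<longrightarrow> i \<in> X" "?y $ i < 0 \<longrightarrow> i \<in> Z" for i
    using y assms(2,4,5) unfolding nth alternating_vectors_def
    by (cases "i = j"; cases "i = k"; force)+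
  ultimately show ?thesis unfolding alternating_vectors_def by blast
qed

text \<open>At the first index where the entries differ, the prefix sums differ by the same amount,
  so one is 0 and the other 1; \<open>u\<close> names the vector with 0. An interval on which the
  order ideal of \<open>v\<close> exceeds that of \<open>u\<close> starts here.\<close>

lemma alternating_vectors_first_difference:
  assumes "y \<in> alternating_vectors X Z" "y' \<in> alternating_vectors X Z" "y \<noteq> y'"
  obtains u v j where "{u, v} = {y, y'}" "prefix_sum u j = 0" "prefix_sum v j = 1" "v $ j = u $ j + 1"
proof -
  let ?D = "{i. y $ i \<noteq> y' $ i}"
  define j where "j = Min ?D"
  have "?D \<noteq> {}" using assms(3) by (auto simp: vec_eq_iff)
  then have j: "y $ j \<noteq> y' $ j" "\<And>i. i < j \<Longrightarrow> y $ i = y' $ i"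
    using Min_in[of ?D] Min_le[of ?D] unfolding j_def by (auto simp: leD)
  have split: "prefix_sum z j = (\<Sum>i<j. z $ i) + z $ j" for z
  proof -
    have "{..j} = insert j {..<j}" by auto
    then show ?thesis by (simp add: prefix_sum_def)
  qed
  have "(\<Sum>i<j. y $ i) = (\<Sum>i<j. y' $ i)" using j(2) by (intro sum.cong) auto
  then have diff: "prefix_sum y j - prefix_sum y' j = y $ j - y' $ j" by (simp add: split)
  have "prefix_sum y j \<in> {0, 1}" "prefix_sum y' j \<in> {0, 1}"
    using assms unfolding alternating_vectors_def by auto
  then consider "prefix_sum y j = 0 \<and> prefix_sum y' j = 1" | "prefix_sum y j = 1 \<and> prefix_sum y' j = 0"
    using diff j(1) by force
  then show ?thesis
  proof cases
    case 1
    with diff show ?thesis by (intro that[of y y' j]) auto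
  next
    case 2
    with diff show ?thesis by (intro that[of y' y j]) auto
  qed
qed

text \<open>
  In terms of prefix sums, alternating vectors are the indicator vectors of the order ideals of a
  fence, so two of them can be exchanged on a maximal interval on which they differ, and cut at any
  intermediate index.
\<close>

lemma alternating_vectors_uncrossing:
  fixes x :: "real ^ 'n::{finite,linorder}"
  assumes "X \<inter> Z = {}" "y \<in> alternating_vectors X Z" "y' \<in> alternating_vectors X Z" "y \<noteq> y'"
    and max: "\<And>z. z \<in> alternating_vectors X Z \<Longrightarrow> x \<bullet> z \<le> x \<bullet> y"
      "\<And>z. z \<in> alternating_vectors X Z \<Longrightarrow> x \<bullet> z \<le> x \<bullet> y'"
  obtains j k where "j \<in> X \<union> Z" "k \<in> X \<union> Z" "j < k" "x $ j = x $ k"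
    "\<And>i. \<lbrakk>j < i; i < k; i \<in> X\<rbrakk> \<Longrightarrow> x $ i \<le> x $ j" "\<And>i. \<lbrakk>j < i; i < k; i \<in> Z\<rbrakk> \<Longrightarrow> x $ j \<le> x $ i"
proof -
  obtain u v j where uv: "{u, v} = {y, y'}" and j: "prefix_sum u j = 0" "prefix_sum v j = 1" "v $ j = u $ j + 1"
    using alternating_vectors_first_difference[OF assms(2-4)] by metis
  then have uv_in: "u \<in> alternating_vectors X Z" "v \<in> alternating_vectors X Z"
    and uv_max: "\<And>z. z \<in> alternating_vectors X Z \<Longrightarrow> x \<bullet> z \<le> x \<bullet> u"
      "\<And>z. z \<in> alternating_vectors X Z \<Longrightarrow> x \<bullet> z \<le> x \<bullet> v"
    using assms(2,3) max by (auto simp: doubleton_eq_iff)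
  have sgn: "0 < u $ i \<Longrightarrow> i \<in> X" "u $ i < 0 \<Longrightarrow> i \<in> Z" "0 < v $ i \<Longrightarrow> i \<in> X" "v $ i < 0 \<Longrightarrow> i \<in> Z" for i
    using uv_in unfolding alternating_vectors_def by auto
  let ?E = "\<lambda>i. prefix_sum u i = 0 \<and> prefix_sum v i = 1"
  let ?K = "{i. j < i \<and> \<not> ?E i}"
  \<comment> \<open>The first index at which the prefix sums cease to be 0 for \<open>u\<close> and
    1 for \<open>v\<close>; it exists because the last prefix sum of \<open>v\<close> is the total
    0.\<close>
  define k where "k = Min ?K"
  have top: "prefix_sum v (Max UNIV) = 0"
  proof -
    have "{..Max (UNIV :: 'n set)} = UNIV" by auto
    then show ?thesis using uv_in(2) by (simp add: prefix_sum_def alternating_vectors_def)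
  qed
  then have "j \<noteq> Max UNIV" using j(2) by auto
  moreover have "j \<le> Max UNIV" by simp
  ultimately have "j < Max UNIV" by order
  with top have "Max UNIV \<in> ?K" by auto
  then have "k \<in> ?K" unfolding k_def by (intro Min_in) auto
  moreover have "i \<notin> ?K" if "i < k" for i
  proof
    assume "i \<in> ?K"
    then have "k \<le> i" unfolding k_def by (intro Min_le) auto
    with that show False by order
  qed
  ultimately have k: "j < k" "\<not> ?E k" "\<And>i. \<lbrakk>j < i; i < k\<rbrakk> \<Longrightarrow> ?E i"
    by blast+
  have E: "?E i" if "j \<le> i" "i < k" for i
    using that k(3) j(1,2) by (cases "i = j") auto
  have u_after: "prefix_sum u i = u $ i" if "j < i" "i \<le> k" for i
    using prefix_sum_after_constant[of j k u 0 i] E that by auto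
  have v_after: "prefix_sum v i = 1 + v $ i" if "j < i" "i \<le> k" for i
    using prefix_sum_after_constant[of j k v 1 i] E that by auto
  have zero: "u $ i = 0" "v $ i = 0" if "j < i" "i < k" for i
    using u_after[of i] v_after[of i] E[of i] that by auto
  have "prefix_sum u k = 0 \<or> prefix_sum u k = 1" "prefix_sum v k = 0 \<or> prefix_sum v k = 1"
    using uv_in unfolding alternating_vectors_def by auto
  \<comment> \<open>If both prefix sums changed at \<open>k\<close>, then \<open>u\<close> would
    open and \<open>v\<close> would close a pair there, which the disjointness of \<open>X\<close>
    and \<open>Z\<close> forbids.\<close>
  then have uvk: "v $ k = u $ k - 1"
  proof (elim disjE)
    assume "prefix_sum u k = 1" "prefix_sum v k = 0"
    then have "u $ k = 1" "v $ k = - 1" using u_after[of k] v_after[of k] k(1) by auto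
    then have "k \<in> X \<inter> Z" using sgn(1)[of k] sgn(4)[of k] by simp
    with assms(1) show ?thesis by simp
  qed (use u_after[of k] v_after[of k] k in auto)
  have prefix: "\<And>i. \<lbrakk>j \<le> i; i < k\<rbrakk> \<Longrightarrow> prefix_sum u i = 0" "\<And>i. \<lbrakk>j \<le> i; i < k\<rbrakk> \<Longrightarrow> prefix_sum v i = 1"
    using E by auto
  have step: "x \<bullet> (z + (axis p 1 - axis q 1)) = x \<bullet> z + x $ p - x $ q"
    "x \<bullet> (z - (axis p 1 - axis q 1)) = x \<bullet> z - x $ p + x $ q" for z p q
    by (simp_all add: inner_add_right inner_diff_right inner_axis)
  \<comment> \<open>Exchanging \<open>u\<close> and \<open>v\<close> on the interval yields two
    competitors; optimality of \<open>u\<close> and of \<open>v\<close> gives the two opposite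
    inequalities.\<close>
  have "u + (axis j 1 - axis k 1) \<in> alternating_vectors X Z"
    using k(1) prefix sgn[of j] sgn[of k] j(3) uvk by (intro alternating_vectors_add uv_in) auto
  from uv_max(1)[OF this] have "x $ j \<le> x $ k" by (simp add: step)
  moreover have "v - (axis j 1 - axis k 1) \<in> alternating_vectors X Z"
    using k(1) prefix sgn[of j] sgn[of k] j(3) uvk by (intro alternating_vectors_diff uv_in) auto
  from uv_max(2)[OF this] have "x $ k \<le> x $ j" by (simp add: step)
  ultimately have eq: "x $ j = x $ k" by simp
  moreover have "x $ i \<le> x $ j" if i: "j < i" "i < k" "i \<in> X" for i
  proof -
    \<comment> \<open>The interval is cut at \<open>i\<close>: an index of \<open>X\<close> may open
      the pair closed at \<open>k\<close>. Dually, an index of \<open>Z\<close> may close the pair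
      opened at \<open>j\<close>.\<close>
    have "u + (axis i 1 - axis k 1) \<in> alternating_vectors X Z"
      using i prefix sgn[of k] uvk by (intro alternating_vectors_add uv_in) auto
    from uv_max(1)[OF this] show ?thesis using eq by (simp add: step)
  qed
  moreover have "x $ j \<le> x $ i" if i: "j < i" "i < k" "i \<in> Z" for i
  proof -
    have "u + (axis j 1 - axis i 1) \<in> alternating_vectors X Z"
      using i prefix sgn[of j] j(3) by (intro alternating_vectors_add uv_in) auto
    from uv_max(1)[OF this] show ?thesis by (simp add: step)
  qed
  moreover have "j \<in> X \<union> Z" using j(3) sgn[of j] by (cases "u $ j < 0") force+
  moreover have "k \<in> X \<union> Z" using uvk sgn[of k] by (cases "u $ k > 0") force+
  ultimately show ?thesis using that k(1) by blast
qed

section \<open>Chambers of the braid arrangement\<close>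

definition indicator_vec :: "'n set \<Rightarrow> real ^ 'n::finite" where
  "indicator_vec S = (\<chi> i. if i \<in> S then 1 else 0)"

lemma indicator_vec_nth [simp]: "indicator_vec S $ i = (if i \<in> S then 1 else 0)"
  by (simp add: indicator_vec_def)

lemma inner_indicator_vec: "indicator_vec S \<bullet> y = (\<Sum>i\<in>S. y $ i)"
  by (simp add: inner_vec_def if_distrib if_distribR sum.If_cases)

text \<open>Ties of \<open>x\<close> put no condition on \<open>y\<close>, so this is the open star
  of the braid cone of \<open>x\<close>: a single braid chamber for injective \<open>x\<close>, and
  two adjacent chambers with the wall between them for a generic point of a wall.\<close>

definition chamber :: "real ^ 'n::finite \<Rightarrow> (real ^ 'n) set" where
  "chamber x = {y. \<forall>i j. x $ i < x $ j \<longrightarrow> y $ i < y $ j}"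

definition closed_chamber :: "real ^ 'n::finite \<Rightarrow> (real ^ 'n) set" where
  "closed_chamber x = {y. \<forall>i j. x $ i < x $ j \<longrightarrow> y $ i \<le> y $ j}"

lemma convex_chamber: "convex (chamber x)"
proof -
  have "{y :: real ^ 'a. y $ i < y $ j} = {y. (axis j 1 - axis i 1) \<bullet> y > 0}" for i j
    by (auto simp: inner_diff_left inner_axis')
  then have "convex {y :: real ^ 'a. y $ i < y $ j}" for i j
    by (simp add: convex_halfspace_gt)
  moreover have "chamber x = (\<Inter>(i, j)\<in>{(i, j). x $ i < x $ j}. {y. y $ i < y $ j})"
    unfolding chamber_def by auto
  ultimately show ?thesis by (auto intro!: convex_INT)
qed

lemma add_scaleR_in_chamber:
  assumes "y \<in> closed_chamber x" "0 < e"
  shows "y + e *\<^sub>R x \<in> chamber x"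
  using assms unfolding chamber_def closed_chamber_def by (auto intro: add_le_less_mono)

lemma in_closure_ray: "y \<in> closure ((\<lambda>e. y + e *\<^sub>R x) ` {0<..})" for y x :: "'a::real_normed_vector"
proof -
  have "\<exists>z\<in>(\<lambda>e. y + e *\<^sub>R x) ` {0<..}. dist z y < e" if "0 < e" for e
  proof -
    let ?d = "e / (norm x + 1)"
    have "0 < norm x + 1" by (simp add: add_nonneg_pos)
    then have "0 < ?d" "?d * norm x < e"
      using that by (simp_all add: field_simps)
    then show ?thesis
      using that by (intro bexI[of _ "y + ?d *\<^sub>R x"]) (auto simp: dist_norm)
  qed
  then show ?thesis by (simp only: closure_approachable) blast
qed

lemma closed_chamber_subset_closure: "closed_chamber x \<subseteq> closure (chamber x)"
proof
  fix y assume "y \<in> closed_chamber x"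
  then have "(\<lambda>e. y + e *\<^sub>R x) ` {0<..} \<subseteq> chamber x" using add_scaleR_in_chamber by auto
  then show "y \<in> closure (chamber x)" using in_closure_ray closure_mono by blast
qed

lemma chamber_common_maximizer:
  assumes "polytope P" "P \<noteq> {}" "chamber x \<inter> kinks P = {}"
  obtains v where "v \<in> P" "\<And>y. y \<in> closed_chamber x \<Longrightarrow> maximizes P y v"
proof -
  obtain v where "v \<in> P" "\<And>y. y \<in> closure (chamber x) \<Longrightarrow> maximizes P y v"
    using connected_common_maximizer[OF assms(1,2) convex_connected[OF convex_chamber] assms(3)] by metis
  with closed_chamber_subset_closure that show ?thesis by (metis subsetD)
qed

definition support_function :: "(real ^ 'n::finite) set \<Rightarrow> 'n set \<Rightarrow> real" where
  "support_function P S = supp P (indicator_vec S)"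

lemma indicator_vec_in_closed_chamber:
  assumes "\<And>i j. \<lbrakk>x $ i < x $ j; i \<in> S\<rbrakk> \<Longrightarrow> j \<in> S"
  shows "indicator_vec S \<in> closed_chamber x"
  using assms by (auto simp: closed_chamber_def)

lemma mixed_difference_support_function_zero:
  assumes "c \<notin> S" "d \<notin> S" "c \<noteq> d"
    and "\<And>T. T \<in> {S, insert c S, insert d S, insert c (insert d S)} \<Longrightarrow> maximizes P (indicator_vec T) v"
  shows "mixed_difference (support_function P) c d S = 0"
proof -
  have "support_function P T = (\<Sum>i\<in>T. v $ i)"
    if "T \<in> {S, insert c S, insert d S, insert c (insert d S)}" for T
    using assms(4)[OF that] by (simp add: support_function_def supp_eq inner_indicator_vec)
  then show ?thesis using assms(1-3) by (simp add: mixed_difference_def)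
qed

text \<open>Ranks counted from 1: in \<open>wall_vector\<close> the entries on \<open>S\<close> are
  then at least 1 and those of the other indices at most -1, which leaves a gap for \<open>c\<close>
  and \<open>d\<close>.\<close>

definition position :: "'n::{finite,linorder} \<Rightarrow> real" where
  "position i = 1 + real (card {..<i})"

lemma position_ge_1: "1 \<le> position i"
  by (simp add: position_def)

lemma position_less: "i < j \<Longrightarrow> position i < position j"
  unfolding position_def by (auto intro!: psubset_card_mono)

lemma position_eq_iff [simp]: "position i = position j \<longleftrightarrow> i = j"
  using position_less[of i j] position_less[of j i] by (metis less_irrefl linorder_neqE)

text \<open>
  \<open>wall_vector S c d 0\<close> is a generic point of the wall \<open>x\<^sub>c = x\<^sub>d\<close> for which \<open>S\<close> is the set of indices
  with larger entries; a small negative last argument moves it off the wall.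
\<close>

definition wall_vector :: "'n::{finite,linorder} set \<Rightarrow> 'n \<Rightarrow> 'n \<Rightarrow> real \<Rightarrow> real ^ 'n::{finite,linorder}" where
  "wall_vector S c d e =
     (\<chi> i. if i \<in> S then position i else if i = c then 0 else if i = d then e else - position i)"

lemma wall_vector_eq:
  assumes "wall_vector S c d e $ i = wall_vector S c d e $ j" "-1 < e" "e \<le> 0" "i \<noteq> j"
  shows "e = 0 \<and> (i = c \<and> j = d \<or> i = d \<and> j = c)"
  using assms position_ge_1[of i] position_ge_1[of j] by (auto simp: wall_vector_def split: if_splits)

lemma ex_tie_break:
  fixes x :: "real ^ 'n::{finite,linorder}"
  obtains x0 :: "real ^ 'n::{finite,linorder}" where "inj (($) x0)" "x \<in> closed_chamber x0"
proof -
  let ?L = "\<lambda>j i. x $ j < x $ i \<or> (x $ j = x $ i \<and> j < i)"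
  define x0 :: "real ^ 'n::{finite,linorder}" where "x0 = (\<chi> i. real (card {j. ?L j i}))"
  have less: "x0 $ i < x0 $ j" if "?L i j" for i j
  proof -
    have "{k. ?L k i} \<subset> {k. ?L k j}"
    proof
      show "{k. ?L k i} \<subseteq> {k. ?L k j}" using that by auto
      show "{k. ?L k i} \<noteq> {k. ?L k j}" using that by blast
    qed
    then have "card {k. ?L k i} < card {k. ?L k j}" by (intro psubset_card_mono) auto
    then show ?thesis by (simp add: x0_def)
  qed
  have total: "i = j \<or> ?L i j \<or> ?L j i" for i j by auto
  have "inj (($) x0)"
  proof (rule injI)
    fix i j assume "x0 $ i = x0 $ j"
    with less[of i j] less[of j i] total[of i j] show "i = j" by auto
  qed
  moreover have "x \<in> closed_chamber x0"
    unfolding closed_chamber_def using less total by (smt (verit) mem_Collect_eq)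
  ultimately show ?thesis using that by blast
qed

section \<open>Walls, and the set functions of polytopes whose kinks lie on them\<close>

context arc_data
begin

text \<open>The union of the shards of the arcs forcing (a, b, A, B), freed from the hyperplane
  condition so that it can be compared directly with chambers and with kinks in the whole
  space.\<close>

definition walls :: "(real ^ 'n::{finite,linorder}) set" where
  "walls = {x. \<exists>c d. a \<le> c \<and> c < d \<and> d \<le> b \<and> x $ c = x $ d \<and>
     (\<forall>i\<in>A \<inter> {c<..<d}. x $ i \<le> x $ c) \<and> (\<forall>i\<in>B \<inter> {c<..<d}. x $ c \<le> x $ i)}"

definition admissible :: "(real ^ 'n::{finite,linorder}) set \<Rightarrow> bool" where
  "admissible P \<longleftrightarrow> polytope P \<and> P \<noteq> {} \<and> P \<subseteq> hyperplane0 \<and> kinks P \<subseteq> walls"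

lemma chamber_eq_nth:
  assumes "y \<in> chamber x" "y $ i = y $ j"
  shows "x $ i = x $ j"
proof -
  have "\<not> x $ i < x $ j" "\<not> x $ j < x $ i" using assms unfolding chamber_def by force+
  then show ?thesis by simp
qed

lemma chamber_disjoint_walls:
  assumes "inj (($) x)"
  shows "chamber x \<inter> walls = {}"
proof -
  have "y \<notin> walls" if "y \<in> chamber x" for y
  proof
    assume "y \<in> walls"
    then obtain c d where "c < d" "y $ c = y $ d" unfolding walls_def by blast
    with injD[OF assms chamber_eq_nth[OF that]] show False by blast
  qed
  then show ?thesis by blast
qed

text \<open>In this set only the entries at \<open>c\<close> and \<open>d\<close> can coincide, so
  only the shard of (c, d) could meet it. That shard wants the entries on \<open>B\<close> above and
  those on \<open>A\<close> below the common value, and here the entries above are those of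
  \<open>S\<close>.\<close>

lemma chamber_wall_vector_disjoint_walls:
  assumes "c < d" "c \<notin> S" "d \<notin> S" and not_wall: "\<not> (a \<le> c \<and> d \<le> b \<and> S \<inter> {c<..<d} = B \<inter> {c<..<d})"
  shows "chamber (wall_vector S c d 0) \<inter> walls = {}"
proof -
  have "y \<notin> walls" if y: "y \<in> chamber (wall_vector S c d 0)" for y
  proof
    assume "y \<in> walls"
    then obtain p q where pq: "a \<le> p" "p < q" "q \<le> b" "y $ p = y $ q"
      "\<forall>i\<in>A \<inter> {p<..<q}. y $ i \<le> y $ p" "\<forall>i\<in>B \<inter> {p<..<q}. y $ p \<le> y $ i"
      unfolding walls_def by blast
    have "p = c \<and> q = d"
      using wall_vector_eq[OF chamber_eq_nth[OF y pq(4)]] pq(2) assms(1) less_imp_neq[OF pq(2)] by auto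
    note pq = pq[unfolded this[THEN conjunct1] this[THEN conjunct2]]
    have "i \<in> S \<longleftrightarrow> i \<in> B" if i: "i \<in> {c<..<d}" for i
    proof
      assume "i \<in> S"
      then have "wall_vector S c d 0 $ c < wall_vector S c d 0 $ i"
        using assms(2) position_ge_1[of i] by (simp add: wall_vector_def)
      then have "y $ c < y $ i" using y unfolding chamber_def by blast
      then have "i \<notin> A" using bspec[OF pq(5), of i] i by auto
      moreover have "i \<in> A \<union> B" using i pq(1,3) cover by auto
      ultimately show "i \<in> B" by blast
    next
      assume "i \<in> B"
      then have "y $ c \<le> y $ i" using pq(6) i by blast
      then have "\<not> wall_vector S c d 0 $ i < wall_vector S c d 0 $ c"
        using y unfolding chamber_def by (metis (mono_tags, lifting) mem_Collect_eq leD)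
      then show "i \<in> S"
        using assms(2) i position_ge_1[of i] by (auto simp: wall_vector_def split: if_splits)
    qed
    then have "S \<inter> {c<..<d} = B \<inter> {c<..<d}" by blast
    with not_wall pq(1,3) show False by blast
  qed
  then show ?thesis by blast
qed

text \<open>All four indicator vectors lie in the closure of one connected set free of kinks, so a
  single point of \<open>P\<close> maximises all four and the set function is modular on
  them.\<close>

lemma mixed_difference_off_walls:
  assumes P: "admissible P" and "c < d" "c \<notin> S" "d \<notin> S"
    and not_wall: "\<not> (a \<le> c \<and> d \<le> b \<and> S \<inter> {c<..<d} = B \<inter> {c<..<d})"
  shows "mixed_difference (support_function P) c d S = 0"
proof -
  have "chamber (wall_vector S c d 0) \<inter> kinks P = {}"
    using chamber_wall_vector_disjoint_walls[OF assms(2-)] P unfolding admissible_def by blast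
  then obtain v where v: "\<And>y. y \<in> closed_chamber (wall_vector S c d 0) \<Longrightarrow> maximizes P y v"
    using P chamber_common_maximizer unfolding admissible_def by metis
  show ?thesis
  proof (rule mixed_difference_support_function_zero)
    fix T assume "T \<in> {S, insert c S, insert d S, insert c (insert d S)}"
    moreover have "\<not> position i < 0" "\<not> 0 < - position i" "\<not> position i < - position j" for i j :: 'n
      using position_ge_1[of i] position_ge_1[of j] by auto
    ultimately have "indicator_vec T \<in> closed_chamber (wall_vector S c d 0)"
      using assms(2-4) by (intro indicator_vec_in_closed_chamber)
        (auto simp: wall_vector_def split: if_splits)
    then show "maximizes P (indicator_vec T) v" by (rule v)
  qed (use assms in auto)
qed

lemma mixed_difference_nonneg:
  assumes P: "admissible P" and "c \<noteq> d" "c \<notin> S" "d \<notin> S"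
  shows "0 \<le> mixed_difference (support_function P) c d S"
proof -
  \<comment> \<open>The value -1/2 lies between the entry 0 at \<open>c\<close> and the entries
    below, which are at most -1. So \<open>S\<close> and \<open>S\<close> with both \<open>c\<close>
    and \<open>d\<close> consist of the largest entries and share a maximiser \<open>v\<close>; at
    the other two sets \<open>v\<close> gives lower bounds, which suffice for the sign.\<close>
  let ?x = "wall_vector S c d (- (1 / 2))"
  have "inj (($) ?x)"
    using wall_vector_eq[of S c d "- (1 / 2)"] by (intro injI) fastforce
  then have "chamber ?x \<inter> kinks P = {}"
    using chamber_disjoint_walls P unfolding admissible_def by blast
  then obtain v where v: "\<And>y. y \<in> closed_chamber ?x \<Longrightarrow> maximizes P y v" and "v \<in> P"
    using P chamber_common_maximizer unfolding admissible_def by metis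
  have pos: "0 < position i" "1 \<le> position i" for i :: 'n
    using position_ge_1[of i] by auto
  have "indicator_vec T \<in> closed_chamber ?x" if "T \<in> {S, insert c (insert d S)}" for T
    using assms that
  proof (intro indicator_vec_in_closed_chamber)
    fix i j assume "?x $ i < ?x $ j" "i \<in> T"
    with that assms pos[of i] pos[of j] show "j \<in> T"
      by (auto simp: wall_vector_def split: if_splits)
  qed
  then have eq: "support_function P T = (\<Sum>i\<in>T. v $ i)" if "T \<in> {S, insert c (insert d S)}" for T
    using supp_eq[OF v, of "indicator_vec T"] that
    by (simp add: support_function_def inner_indicator_vec)
  have le: "(\<Sum>i\<in>T. v $ i) \<le> support_function P T" for T
  proof -
    have "compact P" "P \<noteq> {}" using P unfolding admissible_def by (auto intro: polytope_imp_compact)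
    then obtain w where w: "maximizes P (indicator_vec T) w" using maximizes_exists by metis
    then have "indicator_vec T \<bullet> v \<le> indicator_vec T \<bullet> w"
      using \<open>v \<in> P\<close> unfolding maximizes_def by blast
    with w show ?thesis by (simp add: support_function_def supp_eq inner_indicator_vec)
  qed
  show ?thesis
    using eq[of S] eq[of "insert c (insert d S)"] le[of "insert c S"] le[of "insert d S"] assms
    by (simp add: mixed_difference_def)
qed

text \<open>On a braid chamber one point maximises, and its entries are the successive differences
  of the set function along the chain of up-sets. Hence the two polytopes have a common maximiser in
  every direction.\<close>

lemma admissible_eq_if_support_function_eq:
  assumes P: "admissible P" and Q: "admissible Q"
    and eq: "\<And>S. support_function P S = support_function Q S"
  shows "P = Q"
proof (rule compact_convex_eq_if_common_maximizers)
  show "compact P" "convex P" "compact Q" "convex Q"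
    using P Q unfolding admissible_def by (auto intro: polytope_imp_compact polytope_imp_convex)
  fix x :: "real ^ 'n::{finite,linorder}"
  obtain x0 :: "real ^ 'n::{finite,linorder}" where x0: "inj (($) x0)" "x \<in> closed_chamber x0"
    using ex_tie_break by blast
  have "chamber x0 \<inter> kinks P = {}" "chamber x0 \<inter> kinks Q = {}"
    using chamber_disjoint_walls[OF x0(1)] P Q unfolding admissible_def by blast+
  then obtain v w where v: "\<And>y. y \<in> closed_chamber x0 \<Longrightarrow> maximizes P y v"
    and w: "\<And>y. y \<in> closed_chamber x0 \<Longrightarrow> maximizes Q y w"
    using P Q chamber_common_maximizer unfolding admissible_def by metis
  have sums: "(\<Sum>i\<in>S. v $ i) = (\<Sum>i\<in>S. w $ i)" if "\<And>i j. \<lbrakk>x0 $ i < x0 $ j; i \<in> S\<rbrakk> \<Longrightarrow> j \<in> S" for S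
  proof -
    have "indicator_vec S \<in> closed_chamber x0" using that by (rule indicator_vec_in_closed_chamber)
    then show ?thesis
      using eq[of S] supp_eq[OF v] supp_eq[OF w]
      by (simp add: support_function_def inner_indicator_vec)
  qed
  have "v $ i = w $ i" for i
  proof -
    let ?S = "{j. x0 $ i < x0 $ j}"
    have "{j. x0 $ i \<le> x0 $ j} = insert i ?S"
      using injD[OF x0(1)] by (auto simp: order_le_less)
    moreover have "(\<Sum>j\<in>{j. x0 $ i \<le> x0 $ j}. v $ j) = (\<Sum>j\<in>{j. x0 $ i \<le> x0 $ j}. w $ j)"
      by (rule sums) auto
    moreover have "(\<Sum>j\<in>?S. v $ j) = (\<Sum>j\<in>?S. w $ j)" by (rule sums) auto
    ultimately show ?thesis by simp
  qed
  then have "v = w" by (simp add: vec_eq_iff)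
  then show "\<exists>v. maximizes P x v \<and> maximizes Q x v" using v w x0(2) by blast
qed

lemma support_function_empty: "P \<noteq> {} \<Longrightarrow> support_function P {} = 0"
  by (simp add: support_function_def supp_def inner_indicator_vec)

lemma support_function_UNIV:
  assumes "P \<noteq> {}" "P \<subseteq> hyperplane0"
  shows "support_function P UNIV = 0"
proof -
  have "indicator_vec UNIV \<bullet> y = 0" if "y \<in> P" for y
    using that assms(2) by (auto simp: inner_indicator_vec hyperplane0_def)
  then show ?thesis using assms(1) by (simp add: support_function_def supp_def)
qed

lemma admissible_translation:
  assumes "admissible P" "t \<in> hyperplane0"
  shows "admissible ((+) t ` P)"
proof -
  have "(+) t ` P \<subseteq> hyperplane0"
    using assms unfolding admissible_def hyperplane0_def by (auto simp: sum.distrib)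
  moreover have "polytope ((+) t ` P)"
    using assms(1) polytope_translation_eq[of t P] unfolding admissible_def by simp
  ultimately show ?thesis using assms unfolding admissible_def by (simp add: kinks_translation)
qed

text \<open>The difference of the two set functions has vanishing mixed differences, so it is
  modular; with value 0 at the empty set it is the effect of a translation, and value 0 at
  \<open>UNIV\<close> puts the translation vector into the hyperplane.\<close>

lemma admissible_translate_if_mixed_differences_eq:
  assumes P: "admissible P" and Q: "admissible Q"
    and eq: "\<And>c d. \<lbrakk>a \<le> c; c < d; d \<le> b\<rbrakk> \<Longrightarrow>
      mixed_difference (support_function P) c d (critical_set c d) =
      mixed_difference (support_function Q) c d (critical_set c d)"
  obtains t where "t \<in> hyperplane0" "P = (+) t ` Q"
proof -
  define G where "G S = support_function P S - support_function Q S" for S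
  have G: "mixed_difference G c d S = mixed_difference (support_function P) c d S -
      mixed_difference (support_function Q) c d S" for c d S
    by (simp add: mixed_difference_def G_def)
  have zero: "mixed_difference G c d S = 0" if "c < d" "c \<notin> S" "d \<notin> S" for c d S
  proof (rule mixed_difference_zero)
    fix c d S
    assume "c < d" "c \<notin> S" "d \<notin> S" "\<not> (a \<le> c \<and> d \<le> b \<and> S \<inter> {c<..<d} = B \<inter> {c<..<d})"
    then show "mixed_difference G c d S = 0"
      unfolding G using mixed_difference_off_walls[OF P] mixed_difference_off_walls[OF Q] by simp
  next
    fix c d assume "a \<le> c" "c < d" "d \<le> b"
    then show "mixed_difference G c d (critical_set c d) = 0" unfolding G using eq by simp
  qed (use that in auto)
  have ends: "G {} = 0" "G UNIV = 0"
    using P Q by (simp_all add: G_def admissible_def support_function_empty support_function_UNIV)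
  have modular: "G S = (\<Sum>i\<in>S. G {i})" for S
  proof -
    have "mixed_difference G c d S = 0" if "c \<noteq> d" "c \<notin> S" "d \<notin> S" for c d S
      using that zero[of c d S] zero[of d c S] by (metis linorder_neqE mixed_difference_commute)
    from modular_if_mixed_difference_zero[of G S, OF this] show ?thesis using ends(1) by simp
  qed
  define t where "t = (\<chi> i. G {i})"
  have t: "t \<in> hyperplane0" using ends(2) modular[of UNIV] by (simp add: t_def hyperplane0_def)
  have "P = (+) t ` Q"
  proof (rule admissible_eq_if_support_function_eq[OF P admissible_translation[OF Q t]])
    fix S
    have "compact Q" "Q \<noteq> {}" using Q unfolding admissible_def by (auto intro: polytope_imp_compact)
    then have "support_function ((+) t ` Q) S = G S + support_function Q S"
      unfolding support_function_def supp_translation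
      by (simp add: supp_translation inner_indicator_vec modular[of S] t_def)
    then show "support_function P S = support_function ((+) t ` Q) S" by (simp add: G_def)
  qed
  with t that show ?thesis by blast
qed

end

section \<open>Shard polytopes as a dual basis\<close>

lemma subspace_hyperplane0: "subspace (hyperplane0 :: (real ^ 'm::finite) set)"
  by (auto simp: subspace_def hyperplane0_def sum.distrib simp flip: sum_distrib_left)

lemma sum_lessThan_alternating:
  assumes "z \<in> alternating_vectors X Z"
  shows "(\<Sum>i<k. z $ i) = 0 \<or> (\<Sum>i<k. z $ i) = 1"
proof (cases "{..<k} = {}")
  case False
  then obtain j where "j < k" by blast
  have "{..k} = insert k {..<k}" by auto
  then have "prefix_sum z k = (\<Sum>i<k. z $ i) + z $ k" by (simp add: prefix_sum_def)
  with prefix_sum_step[OF \<open>j < k\<close>, of z] have "(\<Sum>i<k. z $ i) = prefix_sum z (Max {..<k})" by simp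
  then show ?thesis using assms unfolding alternating_vectors_def by auto
qed simp

text \<open>Passing from \<open>T\<close> to \<open>T'\<close> drops only entries that cannot be
  positive and adds only entries that cannot be negative. In the applications \<open>T'\<close> is
  an initial or final segment, empty or \<open>UNIV\<close>, where prefix sums control the
  sum.\<close>

lemma alternating_sum_le:
  assumes z: "z \<in> alternating_vectors X Z" and "(T - T') \<inter> X = {}" "(T' - T) \<inter> Z = {}"
  shows "(\<Sum>i\<in>T. z $ i) \<le> (\<Sum>i\<in>T'. z $ i)"
proof -
  have "(\<Sum>i\<in>T - T'. z $ i) \<le> 0"
    using assms by (intro sum_nonpos) (force simp: alternating_vectors_def not_less[symmetric])
  moreover have "0 \<le> (\<Sum>i\<in>T' - T. z $ i)"
    using assms by (intro sum_nonneg) (force simp: alternating_vectors_def not_less[symmetric])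
  moreover have "(\<Sum>i\<in>T. z $ i) = (\<Sum>i\<in>T \<inter> T'. z $ i) + (\<Sum>i\<in>T - T'. z $ i)"
    "(\<Sum>i\<in>T'. z $ i) = (\<Sum>i\<in>T' \<inter> T. z $ i) + (\<Sum>i\<in>T' - T. z $ i)"
    by (simp_all add: sum.Int_Diff)
  ultimately show ?thesis by (simp add: Int_commute)
qed

lemma zero_in_alternating_vectors: "0 \<in> alternating_vectors X Z"
  by (simp add: alternating_vectors_def)

lemma axis_diff_in_alternating_vectors:
  "\<lbrakk>c < d; c \<in> X; d \<in> Z\<rbrakk> \<Longrightarrow> axis c 1 - axis d 1 \<in> alternating_vectors X Z"
  using alternating_vectors_add[OF zero_in_alternating_vectors, of c d X Z] by simp

context arc_data
begin

abbreviation subarc :: "'n \<Rightarrow> 'n \<Rightarrow> 'n arc" where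
  "subarc c d \<equiv> (c, d, A \<inter> {c<..<d}, B \<inter> {c<..<d})"

abbreviation matchings :: "'n \<Rightarrow> 'n \<Rightarrow> (real ^ 'n::{finite,linorder}) set" where
  "matchings c d \<equiv> alternating_vectors (insert c (A \<inter> {c<..<d})) (insert d (B \<inter> {c<..<d}))"

lemma subarc_cover: "\<lbrakk>a \<le> c; c < d; d \<le> b\<rbrakk> \<Longrightarrow> A \<inter> {c<..<d} \<union> B \<inter> {c<..<d} = {c<..<d}"
proof -
  assume "a \<le> c" "c < d" "d \<le> b"
  then have "{c<..<d} \<subseteq> A \<union> B" unfolding cover by auto
  then show ?thesis by blast
qed

lemma shard_polytope_subarc:
  "\<lbrakk>a \<le> c; c < d; d \<le> b\<rbrakk> \<Longrightarrow> shard_polytope (subarc c d) = convex hull (matchings c d)"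
  using shard_polytope_eq subarc_cover by metis

lemma axis_diff_in_matchings: "c < d \<Longrightarrow> axis c 1 - axis d 1 \<in> matchings c d"
  by (intro axis_diff_in_alternating_vectors) auto

lemma mem_critical_set:
  "i \<in> critical_set c d \<longleftrightarrow> i \<in> B \<and> c < i \<and> i < d \<or> c \<in> A \<and> i < c \<or> d \<in> A \<and> d < i"
  by (auto simp: critical_set_def)

lemma kinks_shard_polytope:
  assumes "a \<le> c" "c < d" "d \<le> b"
  shows "kinks (shard_polytope (subarc c d)) \<subseteq> walls"
proof
  fix x assume "x \<in> kinks (shard_polytope (subarc c d))"
  then have "x \<in> kinks (convex hull (matchings c d))" by (simp add: shard_polytope_subarc[OF assms])
  then obtain y y' where y: "y \<in> matchings c d" "y' \<in> matchings c d" "y \<noteq> y'"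
    "maximizes (convex hull (matchings c d)) x y" "maximizes (convex hull (matchings c d)) x y'"
    using kinks_convex_hullE[OF finite_alternating_vectors] by metis
  let ?X = "insert c (A \<inter> {c<..<d})" and ?Z = "insert d (B \<inter> {c<..<d})"
  have disj: "?X \<inter> ?Z = {}" using assms(2) disjoint by auto
  have max: "\<And>z. z \<in> matchings c d \<Longrightarrow> x \<bullet> z \<le> x \<bullet> y" "\<And>z. z \<in> matchings c d \<Longrightarrow> x \<bullet> z \<le> x \<bullet> y'"
    using y(4,5) unfolding maximizes_def by (simp_all add: hull_inc)
  obtain j k where jk: "j \<in> ?X \<union> ?Z" "k \<in> ?X \<union> ?Z" "j < k" "x $ j = x $ k"
    "\<And>i. \<lbrakk>j < i; i < k; i \<in> ?X\<rbrakk> \<Longrightarrow> x $ i \<le> x $ j" "\<And>i. \<lbrakk>j < i; i < k; i \<in> ?Z\<rbrakk> \<Longrightarrow> x $ j \<le> x $ i"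
    by (rule alternating_vectors_uncrossing[OF disj y(1-3) max]) (assumption | rule that)+
  have "c \<le> j" "j \<le> d" "c \<le> k" "k \<le> d" using jk(1,2) assms(2) by auto
  then have in_cd: "i \<in> {c<..<d}" if "i \<in> {j<..<k}" for i using that by auto
  have "x $ i \<le> x $ j" if "i \<in> A \<inter> {j<..<k}" for i
    using that in_cd[of i] by (intro jk(5)) auto
  moreover have "x $ j \<le> x $ i" if "i \<in> B \<inter> {j<..<k}" for i
    using that in_cd[of i] by (intro jk(6)) auto
  moreover have "a \<le> j" "k \<le> b" using \<open>c \<le> j\<close> \<open>k \<le> d\<close> assms by auto
  ultimately show "x \<in> walls" using jk(3,4) unfolding walls_def by blast
qed

lemma admissible_shard_polytope:
  assumes "a \<le> c" "c < d" "d \<le> b"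
  shows "admissible (shard_polytope (subarc c d))"
  unfolding admissible_def
proof (intro conjI kinks_shard_polytope assms)
  have "matchings c d \<subseteq> hyperplane0" by (auto simp: alternating_vectors_def hyperplane0_def)
  then show "shard_polytope (subarc c d) \<subseteq> hyperplane0"
    unfolding shard_polytope_subarc[OF assms]
    by (intro hull_minimal subspace_imp_convex subspace_hyperplane0)
  show "polytope (shard_polytope (subarc c d))"
    unfolding shard_polytope_subarc[OF assms] by (intro polytope_convex_hull finite_alternating_vectors)
  show "shard_polytope (subarc c d) \<noteq> {}"
    unfolding shard_polytope_subarc[OF assms] using axis_diff_in_matchings[OF assms(2)] by auto
qed

text \<open>The empty matching and the single pair (c, d) both attain the maximum 0 here.\<close>

lemma wall_subset_kinks_shard_polytope:
  assumes cd: "a \<le> c" "c < d" "d \<le> b"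
    and x: "x $ c = x $ d" "\<forall>i\<in>A \<inter> {c<..<d}. x $ i \<le> x $ c" "\<forall>i\<in>B \<inter> {c<..<d}. x $ c \<le> x $ i"
  shows "x \<in> kinks (shard_polytope (subarc c d))"
proof -
  have le: "x \<bullet> y \<le> 0" if y: "y \<in> matchings c d" for y
  proof -
    \<comment> \<open>The entries of \<open>y\<close> sum to 0, so \<open>x $ c\<close> may be
      subtracted throughout; then positive entries of \<open>y\<close> meet nonpositive factors and
      negative ones meet nonnegative factors.\<close>
    have "(x $ i - x $ c) * y $ i \<le> 0" for i
    proof (cases "y $ i" "0 :: real" rule: linorder_cases)
      case less
      then have "i \<in> insert d (B \<inter> {c<..<d})" using y unfolding alternating_vectors_def by blast
      with x less show ?thesis by (auto intro: mult_nonneg_nonpos)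
    next
      case greater
      then have "i \<in> insert c (A \<inter> {c<..<d})" using y unfolding alternating_vectors_def by blast
      with x greater show ?thesis by (auto intro: mult_nonpos_nonneg)
    qed simp
    then have "(\<Sum>i\<in>UNIV. (x $ i - x $ c) * y $ i) \<le> 0" by (intro sum_nonpos) auto
    moreover have "(\<Sum>i\<in>UNIV. (x $ i - x $ c) * y $ i) = x \<bullet> y - x $ c * (\<Sum>i\<in>UNIV. y $ i)"
      by (simp add: inner_vec_def left_diff_distrib sum_subtractf sum_distrib_left)
    ultimately show ?thesis using y by (simp add: alternating_vectors_def)
  qed
  have "x \<bullet> (axis c 1 - axis d 1) = 0" using x(1) by (simp add: inner_diff_right inner_axis)
  then have "maximizes (convex hull matchings c d) x 0"
    "maximizes (convex hull matchings c d) x (axis c 1 - axis d 1)"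
    using le zero_in_alternating_vectors axis_diff_in_matchings[OF cd(2)]
    by (auto intro!: maximizes_convex_hull)
  moreover have "axis c 1 - axis d (1::real) \<noteq> 0" using cd(2) by (auto simp: vec_eq_iff axis_nth_if)
  ultimately show ?thesis unfolding kinks_def shard_polytope_subarc[OF cd] mem_Collect_eq by metis
qed

text \<open>The four values are 0 except for the 1 at \<open>insert c ?S\<close>, attained by the
  pair (c, d): there the opening at \<open>c\<close> counts and the closing at \<open>d\<close> does
  not.\<close>

lemma mixed_difference_shard_polytope_same:
  assumes cd: "a \<le> c" "c < d" "d \<le> b"
  shows "mixed_difference (support_function (shard_polytope (subarc c d))) c d (critical_set c d) = 1"
proof -
  let ?S = "critical_set c d"
  have support: "support_function (shard_polytope (subarc c d)) T = (\<Sum>i\<in>T. y $ i)"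
    if "y \<in> matchings c d" "\<And>z. z \<in> matchings c d \<Longrightarrow> (\<Sum>i\<in>T. z $ i) \<le> (\<Sum>i\<in>T. y $ i)" for y T
    using supp_eq[OF maximizes_convex_hull[OF that(1), of "indicator_vec T"]] that(2)
    by (simp add: support_function_def shard_polytope_subarc[OF cd] inner_indicator_vec)
  have S: "c \<notin> ?S" "d \<notin> ?S" "\<And>i. i \<in> {c<..<d} \<Longrightarrow> i \<in> ?S \<longleftrightarrow> i \<in> B"
    using cd(2) by (auto simp: critical_set_def)
  have AB: "i \<in> A \<Longrightarrow> i \<notin> B" for i using disjoint by blast
  have "support_function (shard_polytope (subarc c d)) ?S = 0"
  proof -
    have "(\<Sum>i\<in>?S. z $ i) \<le> 0" if "z \<in> matchings c d" for z
    proof -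
      have "(\<Sum>i\<in>?S. z $ i) \<le> (\<Sum>i\<in>{}. z $ i)"
        using S AB cd(2) by (intro alternating_sum_le[OF that]) auto
      then show ?thesis by simp
    qed
    then show ?thesis using support[OF zero_in_alternating_vectors] by simp
  qed
  moreover have "support_function (shard_polytope (subarc c d)) (insert d ?S) = 0"
  proof -
    have "(\<Sum>i\<in>insert d ?S. z $ i) \<le> 0" if "z \<in> matchings c d" for z
    proof -
      have "(\<Sum>i\<in>insert d ?S. z $ i) \<le> (\<Sum>i\<in>UNIV. z $ i)"
        using S AB cd(2) by (intro alternating_sum_le[OF that]) auto
      then show ?thesis using that unfolding alternating_vectors_def by simp
    qed
    then show ?thesis using support[OF zero_in_alternating_vectors] by simp
  qed
  moreover have "support_function (shard_polytope (subarc c d)) (insert c (insert d ?S)) = 0"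
  proof -
    have "(\<Sum>i\<in>insert c (insert d ?S). z $ i) \<le> 0" if "z \<in> matchings c d" for z
    proof -
      have "(\<Sum>i\<in>insert c (insert d ?S). z $ i) \<le> (\<Sum>i\<in>UNIV. z $ i)"
        using S AB cd(2) by (intro alternating_sum_le[OF that]) auto
      then show ?thesis using that unfolding alternating_vectors_def by simp
    qed
    then show ?thesis using support[OF zero_in_alternating_vectors] by simp
  qed
  moreover have "support_function (shard_polytope (subarc c d)) (insert c ?S) = 1"
  proof -
    have y: "(\<Sum>i\<in>insert c ?S. (axis c 1 - axis d (1::real)) $ i) = 1"
      using S(1,2) cd(2) by (simp add: axis_nth_if sum_subtractf)
    have "(\<Sum>i\<in>insert c ?S. z $ i) \<le> 1" if "z \<in> matchings c d" for z
    proof -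
      \<comment> \<open>The only possible opening in this set is \<open>c\<close>, and every
        possible closing lies after \<open>c\<close>.\<close>
      have "(\<Sum>i\<in>insert c ?S. z $ i) \<le> (\<Sum>i\<le>c. z $ i)"
        using S AB cd(2) by (intro alternating_sum_le[OF that]) auto
      moreover have "prefix_sum z c \<in> {0, 1}" using that unfolding alternating_vectors_def by blast
      ultimately show ?thesis unfolding prefix_sum_def by auto
    qed
    then show ?thesis using support[OF axis_diff_in_matchings[OF cd(2)]] y by simp
  qed
  ultimately show ?thesis by (simp add: mixed_difference_def)
qed

text \<open>
  At the critical set of a shorter interval, a single matching of \<open>(p, q)\<close> is optimal for all four
  sets of the mixed difference: the pair \<open>(p, q)\<close> itself or the empty matching.
\<close>

lemma mixed_difference_shard_polytope_inside:
  assumes pq: "a \<le> p" "p < q" "q \<le> b" and cd: "p \<le> c" "c < d" "d \<le> q" and ne: "p \<noteq> c \<or> d \<noteq> q"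
  shows "mixed_difference (support_function (shard_polytope (subarc p q))) c d (critical_set c d) = 0"
proof -
  let ?S = "critical_set c d" and ?X = "insert p (A \<inter> {p<..<q})" and ?Z = "insert q (B \<inter> {p<..<q})"
  let ?left = "p = c \<or> c \<in> A" and ?right = "d = q \<or> d \<in> B"
  \<comment> \<open>\<open>?left\<close> puts \<open>p\<close> into all four sets unless
    \<open>p = c\<close>, and \<open>?right\<close> keeps \<open>q\<close> out of all four unless
    \<open>d = q\<close>; by \<open>ne\<close> the two exceptions do not occur together. If both
    hold, the pair (p, q) is optimal; otherwise no matching has a positive value.\<close>
  define y :: "real ^ 'n::{finite,linorder}"
    where "y = (if ?left \<and> ?right then axis p 1 - axis q 1 else 0)"
  have y_in: "y \<in> matchings p q"
    unfolding y_def using axis_diff_in_matchings[OF pq(2)] by (simp add: zero_in_alternating_vectors)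
  have y_sum: "(\<Sum>i\<in>T. y $ i) =
      (if ?left \<and> ?right then (if p \<in> T then 1 else 0) - (if q \<in> T then 1 else 0) else 0)" for T
    by (simp add: y_def axis_nth_if sum_subtractf)
  have AB: "i \<in> A \<longleftrightarrow> i \<notin> B" if "p < i" "i < q" for i
  proof -
    have "i \<in> A \<union> B" unfolding cover using that pq by auto
    then show ?thesis using disjoint by blast
  qed
  have "(\<Sum>i\<in>T. z $ i) \<le> (\<Sum>i\<in>T. y $ i)"
    if T: "T \<in> {?S, insert c ?S, insert d ?S, insert c (insert d ?S)}" and z: "z \<in> matchings p q" for T z
  proof -
    have T_lo: "i \<in> T \<longleftrightarrow> c \<in> A" if "i < c" for i
    proof -
      have "i \<noteq> c" "i \<noteq> d" using that cd(2) by auto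
      then have "i \<in> T \<longleftrightarrow> i \<in> ?S" using T by auto
      then show ?thesis using that cd(2) by (auto simp: mem_critical_set)
    qed
    have T_mid: "i \<in> T \<longleftrightarrow> i \<in> B" if "c < i" "i < d" for i
    proof -
      have "i \<noteq> c" "i \<noteq> d" using that cd(2) by auto
      then have "i \<in> T \<longleftrightarrow> i \<in> ?S" using T by auto
      then show ?thesis using that cd(2) by (auto simp: mem_critical_set)
    qed
    have T_hi: "i \<in> T \<longleftrightarrow> d \<in> A" if "d < i" for i
    proof -
      have "i \<noteq> c" "i \<noteq> d" using that cd(2) by auto
      then have "i \<in> T \<longleftrightarrow> i \<in> ?S" using T by auto
      then show ?thesis using that cd(2) by (auto simp: mem_critical_set)
    qed
    have place: "i < c \<or> i = c \<or> c < i \<and> i < d \<or> i = d \<or> d < i" for i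
      by (meson linorder_less_linear)
    have le: "(\<Sum>i\<in>T. z $ i) \<le> (\<Sum>i\<in>T'. z $ i)" if "(T - T') \<inter> ?X = {}" "(T' - T) \<inter> ?Z = {}" for T'
      using alternating_sum_le[OF z that] .
    have total: "(\<Sum>i\<in>UNIV. z $ i) = 0" using z unfolding alternating_vectors_def by blast
    have pre: "(\<Sum>i\<le>k. z $ i) = 0 \<or> (\<Sum>i\<le>k. z $ i) = 1" for k
      using z unfolding alternating_vectors_def prefix_sum_def by auto
    have pre': "(\<Sum>i<k. z $ i) = 0 \<or> (\<Sum>i<k. z $ i) = 1" for k
      using sum_lessThan_alternating[OF z] .
    have X_cases: "i = p \<or> i \<in> A \<and> i \<notin> B \<and> p < i \<and> i < q" if "i \<in> ?X" for i
      using that disjoint by auto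
    have Z_cases: "i = q \<or> i \<in> B \<and> i \<notin> A \<and> p < i \<and> i < q" if "i \<in> ?Z" for i
      using that disjoint by auto
    show ?thesis
    proof (cases "?left \<and> ?right")
      case True
      then have y: "(\<Sum>i\<in>T. y $ i) = (if p \<in> T then 1 else 0) - (if q \<in> T then 1 else 0)"
        by (simp add: y_sum)
      have p: "p \<in> T" if "p \<noteq> c" using True that cd(1) T_lo[of p] by auto
      have q: "q \<notin> T" if "d \<noteq> q" using True that cd T_hi[of q] AB[of d] by auto
      \<comment> \<open>If \<open>q\<close> is in \<open>T\<close> or \<open>p\<close> is not, the
        pair has value 0. Otherwise its value is 1, and the matching bound is a prefix sum that
        stops at \<open>c\<close> or just before it, depending on whether \<open>c\<close> is in
        \<open>T\<close>.\<close>
      consider "q \<in> T" | "q \<notin> T" "p \<in> T" "c \<in> T" | "q \<notin> T" "p \<in> T" "c \<notin> T" | "q \<notin> T" "p \<notin> T"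
        by blast
      then show ?thesis
      proof cases
        case 1
        then have "d = q" "p \<in> T" using p q ne by auto
        have "i \<in> T" if "i \<in> ?Z" for i
          using Z_cases[OF that] place[of i] T_lo[of i] T_mid[of i] 1 \<open>d = q\<close> True cd by auto
        then have "(\<Sum>i\<in>T. z $ i) \<le> (\<Sum>i\<in>UNIV. z $ i)" by (intro le) auto
        with total y 1 \<open>p \<in> T\<close> show ?thesis by simp
      next
        case 2
        have "i \<le> c" if "i \<in> T" "i \<in> ?X" for i
          using X_cases[OF that(2)] place[of i] T_mid[of i] T_hi[of i] that(1) True cd AB[of d] by auto
        moreover have "i \<in> T" if "i \<le> c" "i \<in> ?Z" for i
          using Z_cases[OF that(2)] T_lo[of i] that(1) 2 True cd by (auto simp: order_le_less)
        ultimately have "(\<Sum>i\<in>T. z $ i) \<le> (\<Sum>i\<le>c. z $ i)" by (intro le) auto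
        with pre[of c] y 2 show ?thesis by auto
      next
        case 3
        have "i < c" if "i \<in> T" "i \<in> ?X" for i
          using X_cases[OF that(2)] place[of i] T_mid[of i] T_hi[of i] that(1) True cd AB[of d] 3 by auto
        moreover have "i \<in> T" if "i < c" "i \<in> ?Z" for i
          using Z_cases[OF that(2)] T_lo[of i] that(1) True cd by auto
        ultimately have "(\<Sum>i\<in>T. z $ i) \<le> (\<Sum>i<c. z $ i)" by (intro le) auto
        with pre'[of c] y 3 show ?thesis by auto
      next
        case 4
        then have "p = c" using p by auto
        have "i \<notin> T" if "i \<in> ?X" for i
          using X_cases[OF that] place[of i] T_mid[of i] T_hi[of i] True cd AB[of d] 4 \<open>p = c\<close> by auto
        then have "(\<Sum>i\<in>T. z $ i) \<le> (\<Sum>i\<in>{}. z $ i)" by (intro le) auto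
        with y 4 show ?thesis by simp
      qed
    next
      case False
      then have y: "(\<Sum>i\<in>T. y $ i) = 0" by (auto simp: y_sum)
      show ?thesis
      proof (cases ?left)
        case True
        then have d: "d < q" "d \<in> A" using False cd AB[of d] by auto
        have "i \<in> T" if "i \<in> ?Z" for i
          using Z_cases[OF that] place[of i] T_lo[of i] T_mid[of i] T_hi[of i] True cd d by auto
        then have "(\<Sum>i\<in>T. z $ i) \<le> (\<Sum>i\<in>UNIV. z $ i)" by (intro le) auto
        with total y show ?thesis by simp
      next
        case left: False
        then have c: "p < c" "c \<in> B" "c \<notin> A" using cd pq AB[of c] by auto
        show ?thesis
        proof (cases ?right)
          case True
          have "i \<notin> T" if "i \<in> ?X" for i
            using X_cases[OF that] place[of i] T_lo[of i] T_mid[of i] T_hi[of i] True cd c AB[of d] by auto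
          then have "(\<Sum>i\<in>T. z $ i) \<le> (\<Sum>i\<in>{}. z $ i)" by (intro le) auto
          with y show ?thesis by simp
        next
          case right: False
          then have d: "d < q" "d \<in> A" using cd AB[of d] by auto
          have X: "d \<le> i" if "i \<in> T" "i \<in> ?X" for i
            using X_cases[OF that(2)] place[of i] T_lo[of i] T_mid[of i] that(1) cd c by auto
          \<comment> \<open>A final segment that treats \<open>d\<close> as \<open>T\<close> does;
            since the total is 0, its sum is minus a prefix sum and hence at most 0.\<close>
          define T' where "T' = (if d \<in> T then {d..} else {d<..})"
          have "(\<Sum>i\<in>T. z $ i) \<le> (\<Sum>i\<in>T'. z $ i)"
          proof (rule le)
            have "i \<in> T'" if "i \<in> T" "i \<in> ?X" for i
              using X[OF that] that(1) by (cases "i = d") (auto simp: T'_def)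
            then show "(T - T') \<inter> ?X = {}" by blast
            have "i \<in> T" if "i \<in> T'" for i
              using that T_hi[of i] d(2) by (cases "i = d") (auto simp: T'_def split: if_splits)
            then show "(T' - T) \<inter> ?Z = {}" by blast
          qed
          moreover have "(\<Sum>i\<in>T'. z $ i) \<le> 0"
          proof -
            have "UNIV = {..<d} \<union> {d..}" "UNIV = {..d} \<union> {d<..}" by auto
            moreover have "(\<Sum>i\<in>{..<d} \<union> {d..}. z $ i) = (\<Sum>i<d. z $ i) + (\<Sum>i\<in>{d..}. z $ i)"
              "(\<Sum>i\<in>{..d} \<union> {d<..}. z $ i) = (\<Sum>i\<le>d. z $ i) + (\<Sum>i\<in>{d<..}. z $ i)"
              by (intro sum.union_disjoint; auto)+
            ultimately have "(\<Sum>i<d. z $ i) + (\<Sum>i\<in>{d..}. z $ i) = 0" "(\<Sum>i\<le>d. z $ i) + (\<Sum>i\<in>{d<..}. z $ i) = 0"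
              using total by simp_all
            with pre[of d] pre'[of d] show ?thesis by (auto simp: T'_def)
          qed
          ultimately show ?thesis using y by simp
        qed
      qed
    qed
  qed
  then have "maximizes (shard_polytope (subarc p q)) (indicator_vec T) y"
    if "T \<in> {?S, insert c ?S, insert d ?S, insert c (insert d ?S)}" for T
    unfolding shard_polytope_subarc[OF pq] using y_in that
    by (intro maximizes_convex_hull) (simp_all add: inner_indicator_vec)
  then show ?thesis
    using critical_set_ends[OF cd(2)] cd(2) by (intro mixed_difference_support_function_zero) auto
qed

text \<open>All points of the polytope vanish at indices outside [p, q], so inserting such an index
  changes nothing and the four terms cancel in pairs.\<close>

lemma mixed_difference_shard_polytope_outside:
  assumes pq: "a \<le> p" "p < q" "q \<le> b" and "c < p \<or> q < d"
  shows "mixed_difference (support_function (shard_polytope (subarc p q))) c d S = 0"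
proof -
  let ?F = "support_function (shard_polytope (subarc p q))"
  have F: "?F (insert e T) = ?F T" if "e < p \<or> q < e" for e T
  proof -
    have "matchings p q \<subseteq> {y. y $ e = 0}"
    proof
      fix y assume y: "y \<in> matchings p q"
      have "e \<notin> insert p (A \<inter> {p<..<q})" "e \<notin> insert q (B \<inter> {p<..<q})" using that pq(2) by auto
      with y have "\<not> 0 < y $ e" "\<not> y $ e < 0" unfolding alternating_vectors_def by blast+
      then show "y \<in> {y. y $ e = 0}" by simp
    qed
    moreover have "convex {y :: real ^ 'n::{finite,linorder}. y $ e = 0}"
      by (intro subspace_imp_convex) (auto simp: subspace_def)
    ultimately have "convex hull (matchings p q) \<subseteq> {y. y $ e = 0}" by (rule hull_minimal)
    then have "indicator_vec (insert e T) \<bullet> y = indicator_vec T \<bullet> y" if "y \<in> shard_polytope (subarc p q)" for y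
      using that unfolding shard_polytope_subarc[OF pq] inner_indicator_vec
      by (auto simp: sum.insert_if)
    then show ?thesis by (simp add: support_function_def supp_def)
  qed
  from assms(4) show ?thesis
  proof
    assume "c < p"
    then show ?thesis using F by (simp add: mixed_difference_def)
  next
    assume "q < d"
    then show ?thesis using F by (simp add: mixed_difference_def insert_commute[of c d])
  qed
qed

lemma mixed_difference_shard_polytope:
  assumes "a \<le> p" "p < q" "q \<le> b" "a \<le> c" "c < d" "d \<le> b"
  shows "mixed_difference (support_function (shard_polytope (subarc p q))) c d (critical_set c d) =
    (if p = c \<and> q = d then 1 else 0)"
proof -
  consider "p = c \<and> q = d" | "p \<le> c" "d \<le> q" "p \<noteq> c \<or> d \<noteq> q" | "c < p \<or> q < d" by force
  then show ?thesis
  proof cases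
    case 1
    with mixed_difference_shard_polytope_same assms show ?thesis by simp
  next
    case 2
    with mixed_difference_shard_polytope_inside[OF assms(1-3) 2(1) assms(5) 2(2,3)] show ?thesis by auto
  next
    case 3
    with mixed_difference_shard_polytope_outside[OF assms(1-3) 3] assms show ?thesis by auto
  qed
qed

end

section \<open>The Cambrian fan\<close>

lemma subtract_mean_in_hyperplane0:
  fixes u :: "real ^ 'm::finite"
  obtains m where "u - m *\<^sub>R 1 \<in> hyperplane0"
proof
  show "u - ((\<Sum>i\<in>UNIV. u $ i) / real CARD('m)) *\<^sub>R 1 \<in> hyperplane0"
    by (simp add: hyperplane0_def sum_subtractf)
qed

lemma inner_one_hyperplane0: "y \<in> hyperplane0 \<Longrightarrow> 1 \<bullet> y = 0"
  by (simp add: hyperplane0_def inner_vec_def)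

lemma kinks_diff_one:
  assumes "P \<subseteq> hyperplane0" "u \<in> kinks P"
  shows "u - m *\<^sub>R 1 \<in> kinks P"
proof -
  have "(u - m *\<^sub>R 1) \<bullet> y = u \<bullet> y" if "y \<in> P" for y
  proof -
    have "1 \<bullet> y = 0" using inner_one_hyperplane0[of y] assms(1) that by blast
    then show ?thesis by (simp add: inner_diff_left)
  qed
  then have "maximizes P (u - m *\<^sub>R 1) v" if "maximizes P u v" for v
    using that by (simp add: maximizes_def)
  with assms(2) show ?thesis unfolding kinks_def by blast
qed

context arc_data
begin

text \<open>The parts of a forcing arc lie in the disjoint sets \<open>A\<close> and
  \<open>B\<close> and together fill its interval, so the endpoints determine them.\<close>

lemma arcs_forcing:
  "{\<alpha>' \<in> arcs. forces \<alpha>' (a, b, A, B)} = {subarc c d | c d. a \<le> c \<and> c < d \<and> d \<le> b}"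
proof (intro equalityI subsetI)
  fix \<beta> assume \<beta>: "\<beta> \<in> {\<alpha>' \<in> arcs. forces \<alpha>' (a, b, A, B)}"
  obtain c d A' B' where eq: "\<beta> = (c, d, A', B')" by (metis prod_cases4)
  have *: "c < d" "A' \<union> B' = {c<..<d}" "A' \<inter> B' = {}" "a \<le> c" "d \<le> b" "A' \<subseteq> A" "B' \<subseteq> B"
    using \<beta> unfolding eq arcs_def by auto
  then have "A' = A \<inter> {c<..<d}" "B' = B \<inter> {c<..<d}" using disjoint by blast+
  with * eq show "\<beta> \<in> {subarc c d | c d. a \<le> c \<and> c < d \<and> d \<le> b}" by blast
next
  fix \<beta> assume "\<beta> \<in> {subarc c d | c d. a \<le> c \<and> c < d \<and> d \<le> b}"
  then obtain c d where *: "\<beta> = subarc c d" "a \<le> c" "c < d" "d \<le> b" by blast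
  have "A \<inter> {c<..<d} \<inter> (B \<inter> {c<..<d}) = {}" using disjoint by blast
  with * subarc_cover[OF *(2-4)] show "\<beta> \<in> {\<alpha>' \<in> arcs. forces \<alpha>' (a, b, A, B)}"
    unfolding arcs_def by simp
qed

lemma Union_shards: "(\<Union>\<alpha>'\<in>{\<alpha>' \<in> arcs. forces \<alpha>' (a, b, A, B)}. shard \<alpha>') = hyperplane0 \<inter> walls"
proof -
  have "(\<Union>\<alpha>'\<in>{\<alpha>' \<in> arcs. forces \<alpha>' (a, b, A, B)}. shard \<alpha>') =
      {x. \<exists>c d. (a \<le> c \<and> c < d \<and> d \<le> b) \<and> x \<in> shard (subarc c d)}"
    unfolding arcs_forcing by blast
  also have "\<dots> = hyperplane0 \<inter> walls"
    unfolding walls_def shard.simps by blast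
  finally show ?thesis .
qed

lemma cambrian_maximal_cones_eq:
  "cambrian_maximal_cones (a, b, A, B) = closure ` components (hyperplane0 - walls)"
  unfolding cambrian_maximal_cones_def Union_shards by (simp add: Diff_Int)

lemma closed_walls: "closed walls"
proof -
  have "walls = (\<Union>(c, d)\<in>{(c, d). a \<le> c \<and> c < d \<and> d \<le> b}. {x. x $ c = x $ d} \<inter>
     (\<Inter>i\<in>A \<inter> {c<..<d}. {x. x $ i \<le> x $ c}) \<inter> (\<Inter>i\<in>B \<inter> {c<..<d}. {x. x $ c \<le> x $ i}))"
    unfolding walls_def by auto
  moreover have "closed ({x :: real ^ 'n::{finite,linorder}. x $ c = x $ d} \<inter>
     (\<Inter>i\<in>A \<inter> {c<..<d}. {x. x $ i \<le> x $ c}) \<inter> (\<Inter>i\<in>B \<inter> {c<..<d}. {x. x $ c \<le> x $ i}))" for c d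
    by (intro closed_Int closed_INT ballI closed_Collect_eq closed_Collect_le continuous_intros)
  ultimately show ?thesis by (auto intro!: closed_UN)
qed

lemma component_openin:
  assumes "U \<in> components (hyperplane0 - walls)" "x \<in> U"
  obtains e where "0 < e" "ball x e \<inter> hyperplane0 \<subseteq> U"
proof -
  have "x \<in> hyperplane0 - walls" using assms in_components_subset by blast
  then obtain e where e: "0 < e" "ball x e \<subseteq> - walls"
    using closed_walls open_contains_ball[of "- walls"] by auto
  have "ball x e \<inter> hyperplane0 \<subseteq> U"
  proof (rule components_maximal[OF assms(1)])
    show "connected (ball x e \<inter> hyperplane0)"
      by (intro convex_connected convex_Int convex_ball subspace_imp_convex subspace_hyperplane0)
    show "ball x e \<inter> hyperplane0 \<subseteq> hyperplane0 - walls" using e(2) by blast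
    show "U \<inter> (ball x e \<inter> hyperplane0) \<noteq> {}"
      using e(1) assms(2) \<open>x \<in> hyperplane0 - walls\<close> by auto
  qed
  with e(1) that show ?thesis by blast
qed

lemma walls_diff_one: "u - m *\<^sub>R 1 \<in> walls \<Longrightarrow> u \<in> walls"
  unfolding walls_def by simp

text \<open>
  A cone of the fan through a point of an open region contains the whole region, since a segment
  ending in this point can be prolonged within the region.
\<close>

lemma cambrian_fan_cone_through_region:
  assumes U: "U \<in> components (hyperplane0 - walls)" and "x \<in> U" "x \<in> F" "F \<in> cambrian_fan (a, b, A, B)"
  shows "U \<subseteq> F"
proof
  fix y assume "y \<in> U"
  have H: "x \<in> hyperplane0" "y \<in> hyperplane0"
    using \<open>x \<in> U\<close> \<open>y \<in> U\<close> in_components_subset[OF U] by auto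
  obtain e where e: "0 < e" "ball x e \<inter> hyperplane0 \<subseteq> U" using component_openin[OF U \<open>x \<in> U\<close>] .
  obtain U' where U': "U' \<in> components (hyperplane0 - walls)" "F face_of closure U'"
    using assms(4) unfolding cambrian_fan_def cambrian_maximal_cones_eq by blast
  have "x \<in> closure U'" using U'(2) assms(3) face_of_imp_subset by blast
  \<comment> \<open>A neighbourhood of \<open>x\<close> in the hyperplane lies in \<open>U\<close>,
    and \<open>x\<close> is in the closure of \<open>U'\<close>; so the two components meet and
    coincide.\<close>
  then obtain z where z: "z \<in> U'" "dist z x < e" using e(1) closure_approachable by blast
  then have "z \<in> U"
    using e(2) in_components_subset[OF U'(1)] by (auto simp: dist_commute)
  then have "U' = U" using components_eq[OF U'(1) U] z(1) by blast
  show "y \<in> F"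
  proof (cases "y = x")
    case False
    define d where "d = e / (2 * norm (x - y))"
    have d: "0 < d" "d * norm (x - y) < e" using False e(1) by (simp_all add: d_def)
    let ?w = "x + d *\<^sub>R (x - y)"
    have "?w \<in> hyperplane0"
      using H subspace_hyperplane0 by (intro subspace_add subspace_scale subspace_diff) auto
    moreover have "?w \<in> ball x e" using d by (simp add: dist_norm)
    ultimately have w: "?w \<in> U" using e(2) by blast
    have "x = (1 - 1 / (1 + d)) *\<^sub>R y + (1 / (1 + d)) *\<^sub>R ?w"
    proof -
      have "(1 + d) *\<^sub>R x = d *\<^sub>R y + ?w" by (simp add: algebra_simps)
      moreover have "1 - 1 / (1 + d) = d / (1 + d)" using d(1) by (simp add: field_simps)
      ultimately have "(1 - 1 / (1 + d)) *\<^sub>R y + (1 / (1 + d)) *\<^sub>R ?w = (1 / (1 + d)) *\<^sub>R ((1 + d) *\<^sub>R x)"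
        by (simp add: scaleR_add_right)
      then show ?thesis using d(1) by simp
    qed
    moreover have "y \<noteq> ?w"
    proof
      assume "y = ?w"
      then have "(1 + d) *\<^sub>R (x - y) = 0" by (simp add: algebra_simps)
      then show False using d(1) False by simp
    qed
    moreover have "0 < 1 / (1 + d)" "1 / (1 + d) < 1" using d(1) by simp_all
    ultimately have "x \<in> open_segment y ?w" unfolding in_segment by blast
    moreover have "y \<in> closure U'" "?w \<in> closure U'"
      using \<open>y \<in> U\<close> w \<open>U' = U\<close> closure_subset by blast+
    ultimately show ?thesis using face_ofD[OF U'(2)] assms(3) by blast
  qed (use assms(3) in simp)
qed

text \<open>Around a kink off the walls, a whole region would lie in the normal cone of the
  maximising face, so two distinct maximisers \<open>p\<close>, \<open>q\<close> would tie
  throughout it; a small move along \<open>p - q\<close> breaks the tie.\<close>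

lemma kinks_subset_walls_if_coarsens:
  assumes P: "polytope P" "P \<noteq> {}" "P \<subseteq> hyperplane0"
    and coarse: "coarsens (normal_fan P) (cambrian_fan (a, b, A, B))"
  shows "kinks P \<subseteq> walls"
proof
  fix u assume "u \<in> kinks P"
  obtain m where m: "u - m *\<^sub>R 1 \<in> hyperplane0" using subtract_mean_in_hyperplane0 .
  define x where "x = u - m *\<^sub>R 1"
  have "x \<in> kinks P" unfolding x_def using kinks_diff_one[OF P(3) \<open>u \<in> kinks P\<close>] .
  have "x \<in> walls"
  proof (rule ccontr)
    assume "x \<notin> walls"
    then have "x \<in> \<Union> (components (hyperplane0 - walls))" using m by (simp add: x_def)
    then obtain U where U: "U \<in> components (hyperplane0 - walls)" "x \<in> U" by blast
    obtain p q where pq: "p \<noteq> q" "maximizes P x p" "maximizes P x q"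
      using \<open>x \<in> kinks P\<close> unfolding kinks_def by blast
    define F where "F = P \<inter> {y. x \<bullet> y = x \<bullet> p}"
    have "F face_of P"
      unfolding F_def using pq(2) polytope_imp_convex[OF P(1)] unfolding maximizes_def
      by (intro face_of_Int_supporting_hyperplane_le) auto
    moreover have F: "p \<in> F" "q \<in> F"
      using pq maximizes_value[OF pq(2,3)] unfolding F_def maximizes_def by auto
    ultimately have "normal_cone P F \<in> normal_fan P" unfolding normal_fan_def by blast
    then obtain \<G> where \<G>: "\<G> \<subseteq> cambrian_fan (a, b, A, B)" "normal_cone P F = \<Union>\<G>"
      using coarse unfolding coarsens_def by blast
    have "x \<in> normal_cone P F"
      using m pq(2) unfolding normal_cone_def F_def x_def[symmetric] maximizes_def by auto
    then obtain G where "G \<in> \<G>" "x \<in> G" using \<G>(2) by blast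
    then have "U \<subseteq> G" using cambrian_fan_cone_through_region[OF U] \<G>(1) by blast
    then have "U \<subseteq> normal_cone P F" using \<G>(2) \<open>G \<in> \<G>\<close> by blast
    then have same: "y \<bullet> p = y \<bullet> q" if "y \<in> U" for y
      using that F unfolding normal_cone_def F_def by (fastforce intro: order_antisym)
    obtain e where e: "0 < e" "ball x e \<inter> hyperplane0 \<subseteq> U" using component_openin[OF U] .
    define d where "d = e / (2 * norm (p - q))"
    have d: "0 < d" "d * norm (p - q) < e" using pq(1) e(1) by (simp_all add: d_def)
    have "x + d *\<^sub>R (p - q) \<in> hyperplane0"
      using m pq P(3) subspace_hyperplane0 unfolding x_def[symmetric] maximizes_def
      by (intro subspace_add subspace_scale subspace_diff) auto
    moreover have "x + d *\<^sub>R (p - q) \<in> ball x e" using d by (simp add: dist_norm)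
    ultimately have "x + d *\<^sub>R (p - q) \<in> U" using e(2) by blast
    from same[OF this] same[OF U(2)] have "d * ((p - q) \<bullet> (p - q)) = 0"
      by (simp add: inner_add_left inner_diff_right algebra_simps)
    then show False using d(1) pq(1) by simp
  qed
  then show "u \<in> walls" unfolding x_def by (rule walls_diff_one)
qed

section \<open>Minkowski sums of admissible polytopes and the coordinates they realise\<close>

lemma admissible_zero: "admissible {0}"
  by (auto simp: admissible_def kinks_def maximizes_def hyperplane0_def polytope_sing)

lemma admissible_add:
  assumes "admissible P" "admissible Q"
  shows "admissible (P + Q)"
proof -
  have PQ: "polytope P" "P \<noteq> {}" "P \<subseteq> hyperplane0" "polytope Q" "Q \<noteq> {}" "Q \<subseteq> hyperplane0"
    "kinks P \<subseteq> walls" "kinks Q \<subseteq> walls"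
    using assms unfolding admissible_def by auto
  have "polytope (P + Q)"
    using PQ(1,4) finite_set_plus unfolding polytope_def by (metis convex_hull_set_plus)
  moreover have "P + Q \<noteq> {}" using PQ(2,5) by (auto simp: set_plus_def)
  moreover have "P + Q \<subseteq> hyperplane0"
    using PQ(3,6) subspace_add[OF subspace_hyperplane0] by (force simp: set_plus_def)
  moreover have "kinks (P + Q) \<subseteq> walls"
    using PQ by (simp add: kinks_Minkowski_sum polytope_imp_compact)
  ultimately show ?thesis unfolding admissible_def by blast
qed

lemma admissible_scaleR:
  assumes "admissible P" "0 \<le> c"
  shows "admissible ((*\<^sub>R) c ` P)"
proof -
  have P: "polytope P" "P \<noteq> {}" "P \<subseteq> hyperplane0" "kinks P \<subseteq> walls"
    using assms unfolding admissible_def by auto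
  have "(*\<^sub>R) c ` P \<subseteq> hyperplane0"
    using P(3) subspace_scale[OF subspace_hyperplane0] by blast
  moreover have "polytope ((*\<^sub>R) c ` P)" using polytope_scaling[OF P(1)] .
  moreover have "kinks ((*\<^sub>R) c ` P) \<subseteq> walls" using kinks_scaleR[OF assms(2), of P] P(4) by blast
  ultimately show ?thesis unfolding admissible_def using P(2) by blast
qed

lemma mixed_difference_support_function_add:
  assumes "admissible P" "admissible Q"
  shows "mixed_difference (support_function (P + Q)) c d S =
    mixed_difference (support_function P) c d S + mixed_difference (support_function Q) c d S"
proof -
  have "support_function (P + Q) T = support_function P T + support_function Q T" for T
    using assms unfolding admissible_def support_function_def
    by (simp add: supp_Minkowski_sum polytope_imp_compact)
  then show ?thesis by (simp add: mixed_difference_def)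
qed

lemma mixed_difference_support_function_scaleR:
  assumes "admissible P" "0 \<le> r"
  shows "mixed_difference (support_function ((*\<^sub>R) r ` P)) c d S =
    r * mixed_difference (support_function P) c d S"
proof -
  have "support_function ((*\<^sub>R) r ` P) T = r * support_function P T" for T
    using assms unfolding admissible_def support_function_def
    by (simp add: supp_scaleR polytope_imp_compact)
  then show ?thesis by (simp add: mixed_difference_def algebra_simps)
qed

abbreviation coordinate :: "'n \<Rightarrow> 'n \<Rightarrow> (real ^ 'n::{finite,linorder}) set \<Rightarrow> real" where
  "coordinate c d P \<equiv> mixed_difference (support_function P) c d (critical_set c d)"

abbreviation intervals :: "('n \<times> 'n) set" where
  "intervals \<equiv> {(c, d). a \<le> c \<and> c < d \<and> d \<le> b}"

lemma coordinate_zero: "coordinate c d {0} = 0"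
  by (simp add: mixed_difference_def support_function_def supp_def)

text \<open>Take the Minkowski sum of the shard polytopes dilated by the numbers
  \<open>w c d\<close>: coordinates are additive and homogeneous, and those of shard polytopes are
  unit vectors.\<close>

lemma ex_admissible_with_coordinates:
  assumes "\<And>c d. 0 \<le> w c d"
  obtains P where "admissible P" "\<And>c d. (c, d) \<in> intervals \<Longrightarrow> coordinate c d P = w c d"
proof -
  have "\<exists>P. admissible P \<and>
      (\<forall>(c, d)\<in>intervals. coordinate c d P = (if (c, d) \<in> I then w c d else 0))"
    if "finite I" "I \<subseteq> intervals" for I
    using that
  proof (induction I rule: finite_induct)
    case empty
    then show ?case using admissible_zero coordinate_zero by (intro exI[of _ "{0}"]) auto
  next
    case (insert pq I)
    obtain p q where pq: "pq = (p, q)" by fastforce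
    have valid: "a \<le> p" "p < q" "q \<le> b" using insert.prems unfolding pq by auto
    obtain P where P: "admissible P"
      "\<forall>(c, d)\<in>intervals. coordinate c d P = (if (c, d) \<in> I then w c d else 0)"
      using insert by auto
    let ?Q = "(*\<^sub>R) (w p q) ` shard_polytope (subarc p q)"
    have Q: "admissible ?Q" using admissible_scaleR[OF admissible_shard_polytope[OF valid] assms] .
    have "coordinate c d (P + ?Q) = (if (c, d) \<in> insert pq I then w c d else 0)"
      if cd: "(c, d) \<in> intervals" for c d
    proof -
      have "coordinate c d ?Q = (if p = c \<and> q = d then w c d else 0)"
        using cd mixed_difference_shard_polytope[OF valid, of c d]
        by (simp add: mixed_difference_support_function_scaleR[OF admissible_shard_polytope[OF valid] assms])
      moreover have "coordinate c d P = (if (c, d) \<in> I then w c d else 0)" using P(2) cd by blast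
      ultimately show ?thesis
        using insert.hyps(2) by (auto simp: mixed_difference_support_function_add[OF P(1) Q] pq)
    qed
    then show ?case using admissible_add[OF P(1) Q] by blast
  qed
  from this[of intervals] that show ?thesis by fastforce
qed

text \<open>The Minkowski sum of all shard polytopes of forcing arcs will do, since kinks of sums
  are unions and each piece of the walls consists of kinks of its own shard polytope.\<close>

lemma ex_admissible_kinks_eq_walls:
  obtains P where "admissible P" "kinks P = walls"
proof -
  have "\<exists>P. admissible P \<and> (\<Union>(c, d)\<in>I. kinks (shard_polytope (subarc c d))) \<subseteq> kinks P"
    if "finite I" "I \<subseteq> intervals" for I
    using that
  proof (induction I rule: finite_induct)
    case empty
    then show ?case using admissible_zero by auto
  next
    case (insert pq I)
    obtain p q where pq: "pq = (p, q)" by fastforce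
    have "admissible (shard_polytope (subarc p q))"
      using insert.prems unfolding pq by (intro admissible_shard_polytope) auto
    moreover obtain P where P: "admissible P" "(\<Union>(c, d)\<in>I. kinks (shard_polytope (subarc c d))) \<subseteq> kinks P"
      using insert by auto
    ultimately have "admissible (P + shard_polytope (subarc p q))"
      "kinks (P + shard_polytope (subarc p q)) = kinks P \<union> kinks (shard_polytope (subarc p q))"
      by (simp_all add: admissible_add) (simp add: admissible_def kinks_Minkowski_sum polytope_imp_compact)
    with P(2) show ?case unfolding pq by (intro exI[of _ "P + shard_polytope (subarc p q)"]) auto
  qed
  from this[OF finite subset_refl] obtain P where P: "admissible P"
    "(\<Union>(c, d)\<in>intervals. kinks (shard_polytope (subarc c d))) \<subseteq> kinks P"
    by (elim exE conjE)
  have "walls \<subseteq> (\<Union>(c, d)\<in>intervals. kinks (shard_polytope (subarc c d)))"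
  proof
    fix x assume "x \<in> walls"
    then obtain c d where cd: "a \<le> c" "c < d" "d \<le> b" "x $ c = x $ d"
      "\<forall>i\<in>A \<inter> {c<..<d}. x $ i \<le> x $ c" "\<forall>i\<in>B \<inter> {c<..<d}. x $ c \<le> x $ i"
      unfolding walls_def by blast
    have "x \<in> kinks (shard_polytope (subarc c d))" by (rule wall_subset_kinks_shard_polytope[OF cd])
    moreover have "(c, d) \<in> intervals" using cd by simp
    ultimately show "x \<in> (\<Union>(c, d)\<in>intervals. kinks (shard_polytope (subarc c d)))"
      by (intro UN_I[of "(c, d)"]) simp_all
  qed
  from this P(2) have "walls \<subseteq> kinks P" by (rule subset_trans)
  moreover have "kinks P \<subseteq> walls" using P(1) unfolding admissible_def by (elim conjE)
  ultimately have "kinks P = walls" by (rule subset_antisym[rotated])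
  with P(1) show ?thesis by (rule that)
qed

end

section \<open>Rays of the type cone\<close>

lemma translation_class_eq_iff:
  "translation_class P = translation_class Q \<longleftrightarrow> (\<exists>t\<in>hyperplane0. P = (+) t ` Q)"
proof
  assume eq: "translation_class P = translation_class Q"
  have "P \<in> translation_class P"
    unfolding translation_class_def by (intro image_eqI[of _ _ 0]) (simp_all add: hyperplane0_def)
  with eq have "P \<in> translation_class Q" by simp
  then show "\<exists>t\<in>hyperplane0. P = (+) t ` Q" unfolding translation_class_def by blast
next
  assume "\<exists>t\<in>hyperplane0. P = (+) t ` Q"
  then obtain t where t: "t \<in> hyperplane0" "P = (+) t ` Q" by blast
  have sub: "translation_class P \<subseteq> translation_class Q"
    if "t \<in> hyperplane0" "P = (+) t ` Q" for t and P Q :: "(real ^ 'a) set"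
  proof
    fix R assume "R \<in> translation_class P"
    then obtain v where v: "v \<in> hyperplane0" "R = (+) v ` P" unfolding translation_class_def by blast
    then have "R = (+) (v + t) ` Q" using that by (simp add: image_image add.assoc)
    moreover have "v + t \<in> hyperplane0" using v that by (simp add: hyperplane0_def sum.distrib)
    ultimately show "R \<in> translation_class Q" unfolding translation_class_def by blast
  qed
  have "Q = (+) (- t) ` P" using t by (simp add: image_image)
  moreover have "- t \<in> hyperplane0" using t by (simp add: hyperplane0_def sum_negf)
  ultimately show "translation_class P = translation_class Q"
    using sub[OF t] sub[of "- t" Q P] by (intro subset_antisym) simp_all
qed

lemma spanned_ray_scaled_translation:
  assumes "t \<in> hyperplane0" "0 < r" "P = (+) t ` (*\<^sub>R) r ` Q"
  shows "spanned_ray P = spanned_ray Q"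
proof -
  have t: "c *\<^sub>R t \<in> hyperplane0" for c using assms(1) by (simp add: hyperplane0_def flip: sum_distrib_left)
  have *: "translation_class ((*\<^sub>R) c ` P) = translation_class ((*\<^sub>R) (c * r) ` Q)" for c
    unfolding translation_class_eq_iff
    by (rule bexI[OF _ t[of c]]) (simp add: assms(3) image_image scaleR_add_right)
  show ?thesis
  proof (intro equalityI subsetI)
    fix C assume "C \<in> spanned_ray P"
    then obtain c where "0 \<le> c" "C = translation_class ((*\<^sub>R) c ` P)" unfolding spanned_ray_def by blast
    moreover have "0 \<le> c * r" using \<open>0 \<le> c\<close> assms(2) by simp
    ultimately show "C \<in> spanned_ray Q" using *[of c] unfolding spanned_ray_def by blast
  next
    fix C assume "C \<in> spanned_ray Q"
    then obtain c where "0 \<le> c" "C = translation_class ((*\<^sub>R) c ` Q)" unfolding spanned_ray_def by blast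
    moreover have "0 \<le> c / r" using \<open>0 \<le> c\<close> assms(2) by simp
    moreover have "c / r * r = c" using assms(2) by simp
    ultimately show "C \<in> spanned_ray P" using *[of "c / r"] unfolding spanned_ray_def by force
  qed
qed

lemma convex_normal_cone: "convex (normal_cone P F)"
proof -
  have "normal_cone P F = hyperplane0 \<inter> (\<Inter>x\<in>F. \<Inter>y\<in>P. {u. (y - x) \<bullet> u \<le> 0})"
    unfolding normal_cone_def by (auto simp: inner_diff_right inner_commute)
  then show ?thesis
    by (simp only:) (intro convex_Int convex_INT convex_halfspace_le subspace_imp_convex subspace_hyperplane0)
qed

section \<open>Convexity of the regions, and the type cone in coordinates\<close>

context arc_data
begin

text \<open>With \<open>P\<close> having exactly the walls as kinks, the region turns out to be the
  set \<open>V\<close> of directions in the hyperplane in which one fixed point \<open>v\<close> of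
  \<open>P\<close> is the unique maximiser.\<close>

lemma convex_region:
  assumes U: "U \<in> components (hyperplane0 - walls)"
  shows "convex U"
proof -
  obtain P where P: "admissible P" "kinks P = walls" using ex_admissible_kinks_eq_walls .
  have "U \<inter> kinks P = {}" using in_components_subset[OF U] P(2) by blast
  then obtain v where v: "v \<in> P" "\<And>y. y \<in> closure U \<Longrightarrow> maximizes P y v"
    using P(1) connected_common_maximizer in_components_connected[OF U] unfolding admissible_def by metis
  define V where "V = hyperplane0 \<inter> (\<Inter>w\<in>P - {v}. {u. (w - v) \<bullet> u < 0})"
  have "convex V"
    unfolding V_def by (intro convex_Int convex_INT convex_halfspace_lt subspace_imp_convex subspace_hyperplane0)
  have "U \<subseteq> V"
  proof
    fix u assume "u \<in> U"
    then have u: "maximizes P u v" "u \<in> hyperplane0" "u \<notin> kinks P"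
      using v(2) closure_subset in_components_subset[OF U] P(2) by blast+
    have "(w - v) \<bullet> u < 0" if w: "w \<in> P - {v}" for w
    proof (rule ccontr)
      assume "\<not> ?thesis"
      then have "u \<bullet> v \<le> u \<bullet> w" by (simp add: inner_diff_right inner_commute)
      then have "maximizes P u w" using u(1) w unfolding maximizes_def by auto
      then have "u \<in> kinks P" using u(1) w unfolding kinks_def by blast
      with u(3) show False by contradiction
    qed
    with u(2) show "u \<in> V" unfolding V_def by simp
  qed
  have "u \<notin> kinks P" if "u \<in> V" for u
  proof -
    have less: "u \<bullet> w < u \<bullet> v" if "w \<in> P" "w \<noteq> v" for w
    proof -
      have "(w - v) \<bullet> u < 0" using \<open>u \<in> V\<close> that unfolding V_def by blast
      then show ?thesis by (simp add: inner_diff_right inner_commute)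
    qed
    have "w = v" if "maximizes P u w" for w
      using that less[of w] v(1) unfolding maximizes_def by force
    then show ?thesis unfolding kinks_def by blast
  qed
  then have "V \<subseteq> hyperplane0 - walls" unfolding P(2) V_def by blast
  moreover have "U \<inter> V \<noteq> {}" using \<open>U \<subseteq> V\<close> in_components_nonempty[OF U] by blast
  ultimately have "V \<subseteq> U" using components_maximal[OF U convex_connected[OF \<open>convex V\<close>]] by blast
  with \<open>U \<subseteq> V\<close> \<open>convex V\<close> show ?thesis by (simp add: subset_antisym)
qed

text \<open>Breaking the ties of \<open>x\<close> gives a braid chamber with \<open>x\<close> in its
  closure; its part in the hyperplane is connected and avoids the walls, so it lies in a single
  region.\<close>

lemma closure_regions_cover:
  assumes "x \<in> hyperplane0"
  obtains U where "U \<in> components (hyperplane0 - walls)" "x \<in> closure U"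
proof -
  obtain x0 where x0: "inj (($) x0)" "x \<in> closed_chamber x0" using ex_tie_break .
  obtain m where m: "x0 - m *\<^sub>R 1 \<in> hyperplane0" using subtract_mean_in_hyperplane0 .
  define x1 where "x1 = x0 - m *\<^sub>R 1"
  have x1: "inj (($) x1)" "x \<in> closed_chamber x1" "x1 \<in> chamber x1" "x1 \<in> hyperplane0"
    using x0 m by (auto simp: x1_def inj_def closed_chamber_def chamber_def)
  let ?W = "chamber x1 \<inter> hyperplane0"
  have W: "?W \<subseteq> hyperplane0 - walls" using chamber_disjoint_walls[OF x1(1)] by blast
  then have "x1 \<in> \<Union> (components (hyperplane0 - walls))" unfolding Union_components using x1 by blast
  then obtain U where U: "U \<in> components (hyperplane0 - walls)" "x1 \<in> U" by blast
  have "connected ?W"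
    by (intro convex_connected convex_Int convex_chamber subspace_imp_convex subspace_hyperplane0)
  then have "?W \<subseteq> U" using components_maximal[OF U(1) _ W] U(2) x1 by blast
  moreover have "(\<lambda>e. x + e *\<^sub>R x1) ` {0<..} \<subseteq> ?W"
  proof (rule image_subsetI)
    fix e :: real assume "e \<in> {0<..}"
    then have "x + e *\<^sub>R x1 \<in> chamber x1" using add_scaleR_in_chamber[OF x1(2)] by simp
    moreover have "x + e *\<^sub>R x1 \<in> hyperplane0"
      using assms x1(4) by (intro subspace_add subspace_scale subspace_hyperplane0)
    ultimately show "x + e *\<^sub>R x1 \<in> ?W" by blast
  qed
  ultimately have "(\<lambda>e. x + e *\<^sub>R x1) ` {0<..} \<subseteq> U" by (rule subset_trans[rotated])
  then have "x \<in> closure U" using in_closure_ray closure_mono by blast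
  with U(1) show ?thesis by (rule that)
qed

text \<open>On the closure of the region one point \<open>v\<close> maximises, so the normal cone is
  cut out there by the vanishing of the nonnegative linear functions taking \<open>u\<close> to
  \<open>u \<bullet> v - u \<bullet> x\<close> for \<open>x\<close> in \<open>F\<close>; such a zero
  set is a face.\<close>

lemma normal_cone_Int_region_face:
  assumes P: "admissible P" and U: "U \<in> components (hyperplane0 - walls)" and "F \<subseteq> P"
  shows "(normal_cone P F \<inter> closure U) face_of closure U"
proof -
  have "U \<inter> kinks P = {}" using in_components_subset[OF U] P unfolding admissible_def by blast
  then obtain v where v: "v \<in> P" "\<And>y. y \<in> closure U \<Longrightarrow> maximizes P y v"
    using P connected_common_maximizer in_components_connected[OF U] unfolding admissible_def by metis
  have "closure U \<subseteq> hyperplane0"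
    using in_components_subset[OF U] by (intro closure_minimal closed_subspace subspace_hyperplane0) blast
  then have in_cone: "u \<in> normal_cone P F" if "u \<in> closure U" "\<And>x. x \<in> F \<Longrightarrow> u \<bullet> v \<le> u \<bullet> x" for u
  proof -
    have "u \<bullet> y \<le> u \<bullet> x" if x: "x \<in> F" and y: "y \<in> P" for x y
    proof -
      have "u \<bullet> y \<le> u \<bullet> v" using v(2)[OF \<open>u \<in> closure U\<close>] y unfolding maximizes_def by blast
      also have "\<dots> \<le> u \<bullet> x" using \<open>\<And>x. x \<in> F \<Longrightarrow> u \<bullet> v \<le> u \<bullet> x\<close> x .
      finally show ?thesis .
    qed
    moreover have "u \<in> hyperplane0" using that(1) \<open>closure U \<subseteq> hyperplane0\<close> by blast
    ultimately show ?thesis unfolding normal_cone_def by simp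
  qed
  show ?thesis
    unfolding face_of_def
  proof (intro conjI ballI impI)
    show "convex (normal_cone P F \<inter> closure U)"
      by (intro convex_Int convex_normal_cone convex_closure convex_region U)
    fix u1 u2 u
    assume u1: "u1 \<in> closure U" and u2: "u2 \<in> closure U" and u: "u \<in> normal_cone P F \<inter> closure U"
      and "u \<in> open_segment u1 u2"
    then obtain s where s: "0 < s" "s < 1" "u = (1 - s) *\<^sub>R u1 + s *\<^sub>R u2" unfolding in_segment by blast
    have "u1 \<bullet> v \<le> u1 \<bullet> x \<and> u2 \<bullet> v \<le> u2 \<bullet> x" if "x \<in> F" for x
    proof -
      have "u \<bullet> v \<le> u \<bullet> x" using u that v(1) unfolding normal_cone_def by blast
      then have le: "(1 - s) * (u1 \<bullet> v - u1 \<bullet> x) + s * (u2 \<bullet> v - u2 \<bullet> x) \<le> 0"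
        by (simp add: s(3) inner_add_left algebra_simps)
      have ge: "0 \<le> u1 \<bullet> v - u1 \<bullet> x" "0 \<le> u2 \<bullet> v - u2 \<bullet> x"
        using v(2)[OF u1] v(2)[OF u2] that assms(3) unfolding maximizes_def by auto
      then have "0 \<le> (1 - s) * (u1 \<bullet> v - u1 \<bullet> x)" "0 \<le> s * (u2 \<bullet> v - u2 \<bullet> x)"
        using s by simp_all
      with le have "(1 - s) * (u1 \<bullet> v - u1 \<bullet> x) = 0" "s * (u2 \<bullet> v - u2 \<bullet> x) = 0" by linarith+
      then show ?thesis using s by simp
    qed
    then show "u1 \<in> normal_cone P F \<inter> closure U" "u2 \<in> normal_cone P F \<inter> closure U"
      using in_cone[OF u1] in_cone[OF u2] u1 u2 by blast+
  qed simp
qed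

lemma coarsens_if_admissible:
  assumes "admissible P"
  shows "coarsens (normal_fan P) (cambrian_fan (a, b, A, B))"
  unfolding coarsens_def
proof
  fix N assume "N \<in> normal_fan P"
  then obtain F where F: "N = normal_cone P F" "F face_of P" unfolding normal_fan_def by blast
  have "F \<subseteq> P" using F(2) by (rule face_of_imp_subset)
  \<comment> \<open>Empty intersections are left out because cones of the fan are nonempty by
    definition.\<close>
  let ?G = "{N \<inter> closure U | U. U \<in> components (hyperplane0 - walls) \<and> N \<inter> closure U \<noteq> {}}"
  have "?G \<subseteq> cambrian_fan (a, b, A, B)"
    using normal_cone_Int_region_face[OF assms _ \<open>F \<subseteq> P\<close>]
    unfolding cambrian_fan_def cambrian_maximal_cones_eq F(1) by auto
  moreover have "N = \<Union>?G"
  proof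
    show "N \<subseteq> \<Union>?G"
    proof
      fix x assume "x \<in> N"
      then have "x \<in> hyperplane0" unfolding F(1) normal_cone_def by simp
      then obtain U where "U \<in> components (hyperplane0 - walls)" "x \<in> closure U"
        using closure_regions_cover by metis
      with \<open>x \<in> N\<close> show "x \<in> \<Union>?G" by blast
    qed
  qed blast
  ultimately show "\<exists>\<G>\<subseteq>cambrian_fan (a, b, A, B). N = \<Union>\<G>" by blast
qed

abbreviation deformations :: "(real ^ 'n::{finite,linorder}) set set set" where
  "deformations \<equiv> type_cone (cambrian_fan (a, b, A, B))"

lemma translation_class_in_deformations: "translation_class P \<in> deformations \<longleftrightarrow> admissible P"
proof
  assume "translation_class P \<in> deformations"
  then obtain Q where Q: "translation_class P = translation_class Q" "polytope Q" "Q \<noteq> {}"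
    "Q \<subseteq> hyperplane0" "coarsens (normal_fan Q) (cambrian_fan (a, b, A, B))"
    unfolding type_cone_def by blast
  then have "admissible Q" using kinks_subset_walls_if_coarsens unfolding admissible_def by simp
  moreover obtain t where "t \<in> hyperplane0" "P = (+) t ` Q" using Q(1) unfolding translation_class_eq_iff by blast
  ultimately show "admissible P" using admissible_translation by simp
next
  assume "admissible P"
  then show "translation_class P \<in> deformations"
    using coarsens_if_admissible unfolding type_cone_def admissible_def by simp
qed

lemma mixed_difference_translation:
  assumes "admissible P" "c \<noteq> d" "c \<notin> S" "d \<notin> S"
  shows "mixed_difference (support_function ((+) t ` P)) c d S = mixed_difference (support_function P) c d S"
proof -
  have "support_function ((+) t ` P) T = (\<Sum>i\<in>T. t $ i) + support_function P T" for T
    using assms(1) unfolding admissible_def support_function_def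
    by (simp add: supp_translation polytope_imp_compact inner_indicator_vec)
  then show ?thesis using assms(2-) by (simp add: mixed_difference_def)
qed

lemma coordinate_translation:
  "\<lbrakk>admissible P; c < d\<rbrakk> \<Longrightarrow> coordinate c d ((+) t ` P) = coordinate c d P"
  using critical_set_ends by (intro mixed_difference_translation) auto

lemma coordinate_nonneg: "\<lbrakk>admissible P; c < d\<rbrakk> \<Longrightarrow> 0 \<le> coordinate c d P"
  using critical_set_ends by (intro mixed_difference_nonneg) auto

lemma translation_class_in_spanned_ray_shard_polytope:
  assumes pq: "a \<le> p" "p < q" "q \<le> b" and Q: "admissible Q"
    and zero: "\<And>c d. \<lbrakk>a \<le> c; c < d; d \<le> b; (c, d) \<noteq> (p, q)\<rbrakk> \<Longrightarrow> coordinate c d Q = 0"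
  shows "translation_class Q \<in> spanned_ray (shard_polytope (subarc p q))"
proof -
  let ?r = "coordinate p q Q" and ?P = "shard_polytope (subarc p q)"
  have P: "admissible ?P" using admissible_shard_polytope[OF pq] .
  have r: "0 \<le> ?r" using coordinate_nonneg[OF Q pq(2)] .
  have "coordinate c d Q = coordinate c d ((*\<^sub>R) ?r ` ?P)" if "a \<le> c" "c < d" "d \<le> b" for c d
    using zero[OF that] mixed_difference_shard_polytope[OF pq that]
    by (auto simp: mixed_difference_support_function_scaleR[OF P r])
  then obtain t where "t \<in> hyperplane0" "Q = (+) t ` (*\<^sub>R) ?r ` ?P"
    using admissible_translate_if_mixed_differences_eq[OF Q admissible_scaleR[OF P r]] by metis
  then have "translation_class Q = translation_class ((*\<^sub>R) ?r ` ?P)"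
    unfolding translation_class_eq_iff by blast
  with r show ?thesis unfolding spanned_ray_def by blast
qed

text \<open>The coordinates of the two summands are nonnegative and add up to a unit vector, so each
  summand has coordinate 0 away from (p, q) and is a translated dilate of the shard
  polytope.\<close>

lemma extremal_shard_polytope:
  assumes pq: "a \<le> p" "p < q" "q \<le> b"
  shows "extremal_in deformations (shard_polytope (subarc p q))"
proof -
  let ?P = "shard_polytope (subarc p q)"
  have P: "admissible ?P" using admissible_shard_polytope[OF pq] .
  have "translation_class ?P \<noteq> translation_class {0}"
  proof
    assume "translation_class ?P = translation_class {0}"
    then obtain t where "?P = (+) t ` {0}" unfolding translation_class_eq_iff by blast
    then have "coordinate p q ?P = coordinate p q {0}"
      using coordinate_translation[OF admissible_zero pq(2)] by simp
    with mixed_difference_shard_polytope[OF pq pq] show False by (simp add: coordinate_zero)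
  qed
  moreover have left: "translation_class Q \<in> spanned_ray ?P"
    if Q: "translation_class Q \<in> deformations" and R: "translation_class R \<in> deformations"
      and eq: "translation_class (Q + R) = translation_class ?P" for Q R
  proof (rule translation_class_in_spanned_ray_shard_polytope[OF pq])
    show "admissible Q" using Q translation_class_in_deformations by simp
    have "admissible R" using R translation_class_in_deformations by simp
    fix c d assume cd: "a \<le> c" "c < d" "d \<le> b" "(c, d) \<noteq> (p, q)"
    obtain t where t: "Q + R = (+) t ` ?P" using eq unfolding translation_class_eq_iff by blast
    have "coordinate c d (Q + R) = coordinate c d ?P"
      unfolding t using coordinate_translation[OF P cd(2)] .
    also have "\<dots> = 0" using mixed_difference_shard_polytope[OF pq cd(1-3)] cd(4) by auto
    finally have "coordinate c d Q + coordinate c d R = 0"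
      by (simp add: mixed_difference_support_function_add[OF \<open>admissible Q\<close> \<open>admissible R\<close>])
    then show "coordinate c d Q = 0"
      using coordinate_nonneg[OF \<open>admissible Q\<close> cd(2)] coordinate_nonneg[OF \<open>admissible R\<close> cd(2)] by linarith
  qed
  moreover have "translation_class R \<in> spanned_ray ?P"
    if "translation_class Q \<in> deformations" "translation_class R \<in> deformations"
      "translation_class (Q + R) = translation_class ?P" for Q R
    using left[OF that(2,1)] that(3) by (simp add: add.commute)
  moreover have "translation_class ?P \<in> deformations" using P translation_class_in_deformations by simp
  ultimately show ?thesis unfolding extremal_in_def by blast
qed

text \<open>Some coordinate is nonzero because \<open>P\<close> is not a point. Splitting off the
  corresponding multiple \<open>Q\<close> of a shard polytope leaves nonnegative coordinates,
  realised by some \<open>R\<close>; extremality then puts \<open>Q\<close> on the ray of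
  \<open>P\<close>.\<close>

lemma spanned_ray_of_extremal:
  assumes "extremal_in deformations P"
  obtains p q where "a \<le> p" "p < q" "q \<le> b" "spanned_ray P = spanned_ray (shard_polytope (subarc p q))"
proof -
  have P: "admissible P" using assms unfolding extremal_in_def translation_class_in_deformations by blast
  have "\<exists>p q. a \<le> p \<and> p < q \<and> q \<le> b \<and> coordinate p q P \<noteq> 0"
  proof (rule ccontr)
    assume "\<not> ?thesis"
    then have "coordinate c d P = coordinate c d {0}" if "a \<le> c" "c < d" "d \<le> b" for c d
      using that by (simp add: coordinate_zero)
    then obtain t where "t \<in> hyperplane0" "P = (+) t ` {0}"
      using admissible_translate_if_mixed_differences_eq[OF P admissible_zero] by metis
    then have "translation_class P = translation_class {0}" unfolding translation_class_eq_iff by blast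
    with assms show False unfolding extremal_in_def by blast
  qed
  then obtain p q where pq: "a \<le> p" "p < q" "q \<le> b" "coordinate p q P \<noteq> 0" by blast
  define r where "r = coordinate p q P"
  have r: "0 < r" using coordinate_nonneg[OF P pq(2)] pq(4) by (simp add: r_def)
  let ?S = "shard_polytope (subarc p q)"
  have S: "admissible ?S" using admissible_shard_polytope[OF pq(1-3)] .
  define Q where "Q = (*\<^sub>R) r ` ?S"
  have Q: "admissible Q" unfolding Q_def using admissible_scaleR[OF S] r by simp
  have coordinate_Q: "coordinate c d Q = (if (c, d) = (p, q) then r else 0)"
    if "a \<le> c" "c < d" "d \<le> b" for c d
    using mixed_difference_shard_polytope[OF pq(1-3) that] r
    by (auto simp: Q_def mixed_difference_support_function_scaleR[OF S])
  \<comment> \<open>The test \<open>c < d\<close> makes \<open>w\<close> nonnegative for all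
    arguments, as the existence lemma demands; nonnegativity of coordinates is available for
    \<open>c < d\<close>.\<close>
  define w where "w c d = (if c < d \<and> (c, d) \<noteq> (p, q) then coordinate c d P else 0)" for c d
  have w: "0 \<le> w c d" for c d using coordinate_nonneg[OF P] by (simp add: w_def)
  obtain R where R: "admissible R" "\<And>c d. (c, d) \<in> intervals \<Longrightarrow> coordinate c d R = w c d"
    by (rule ex_admissible_with_coordinates[OF w]) (rule that)
  have "coordinate c d (Q + R) = coordinate c d P" if "a \<le> c" "c < d" "d \<le> b" for c d
    using coordinate_Q[OF that] R(2)[of c d] that
    by (auto simp: mixed_difference_support_function_add[OF Q R(1)] w_def r_def)
  then obtain t where "t \<in> hyperplane0" "Q + R = (+) t ` P"
    using admissible_translate_if_mixed_differences_eq[OF admissible_add[OF Q R(1)] P] by metis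
  then have "translation_class (Q + R) = translation_class P" unfolding translation_class_eq_iff by blast
  then have "translation_class Q \<in> spanned_ray P"
    using assms Q R(1) unfolding extremal_in_def translation_class_in_deformations by blast
  then obtain c where c: "0 \<le> c" "translation_class Q = translation_class ((*\<^sub>R) c ` P)"
    unfolding spanned_ray_def by blast
  then obtain s where s: "s \<in> hyperplane0" "Q = (+) s ` (*\<^sub>R) c ` P"
    unfolding translation_class_eq_iff by blast
  have "coordinate p q Q = c * r"
    unfolding s(2) r_def using coordinate_translation[OF admissible_scaleR[OF P c(1)] pq(2)]
    by (simp add: mixed_difference_support_function_scaleR[OF P c(1)])
  \<comment> \<open>\<open>P\<close> and \<open>Q\<close> have the same positive coordinate
    \<open>r\<close> at (p, q), which fixes the factor and excludes the degenerate value 0.\<close>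
  with coordinate_Q[OF pq(1-3)] r have "c = 1" by simp
  then have "spanned_ray Q = spanned_ray P"
    using spanned_ray_scaled_translation[OF s(1) _ s(2)] by simp
  moreover have "spanned_ray Q = spanned_ray ?S"
    using r by (intro spanned_ray_scaled_translation[of 0 r]) (simp_all add: Q_def hyperplane0_def)
  ultimately show ?thesis using that pq(1-3) by simp
qed

lemma cone_rays_deformations:
  "cone_rays deformations =
    {spanned_ray (shard_polytope \<alpha>') | \<alpha>'. \<alpha>' \<in> arcs \<and> forces \<alpha>' (a, b, A, B)}"
proof -
  have "{spanned_ray (shard_polytope \<alpha>') | \<alpha>'. \<alpha>' \<in> arcs \<and> forces \<alpha>' (a, b, A, B)} =
      (\<lambda>\<alpha>'. spanned_ray (shard_polytope \<alpha>')) ` {\<alpha>' \<in> arcs. forces \<alpha>' (a, b, A, B)}"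
    by blast
  also have "\<dots> = {spanned_ray (shard_polytope (subarc c d)) | c d. a \<le> c \<and> c < d \<and> d \<le> b}"
    unfolding arcs_forcing by blast
  also have "\<dots> = cone_rays deformations"
  proof (intro equalityI subsetI)
    fix \<rho> assume "\<rho> \<in> {spanned_ray (shard_polytope (subarc c d)) | c d. a \<le> c \<and> c < d \<and> d \<le> b}"
    then obtain c d where "\<rho> = spanned_ray (shard_polytope (subarc c d))" "a \<le> c" "c < d" "d \<le> b" by blast
    then show "\<rho> \<in> cone_rays deformations"
      using extremal_shard_polytope unfolding cone_rays_def by simp
  next
    fix \<rho> assume "\<rho> \<in> cone_rays deformations"
    then obtain P where "extremal_in deformations P" "\<rho> = spanned_ray P" unfolding cone_rays_def by blast
    moreover from spanned_ray_of_extremal[OF this(1)] obtain p q where "a \<le> p" "p < q" "q \<le> b"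
      "spanned_ray P = spanned_ray (shard_polytope (subarc p q))" .
    ultimately show "\<rho> \<in> {spanned_ray (shard_polytope (subarc c d)) | c d. a \<le> c \<and> c < d \<and> d \<le> b}"
      by blast
  qed
  finally show ?thesis by (rule sym)
qed

end

theorem theorem65:
  fixes \<alpha> :: "'n::{finite,linorder} arc"
  assumes "\<alpha> \<in> arcs"
  shows "cone_rays (type_cone (cambrian_fan \<alpha>)) =
    {spanned_ray (shard_polytope \<alpha>') | \<alpha>'. \<alpha>' \<in> arcs \<and> forces \<alpha>' \<alpha>}"
proof -
  obtain a b A B where \<alpha>: "\<alpha> = (a, b, A, B)" by (metis prod_cases4)
  then interpret arc_data a b A B
    using assms by unfold_locales (auto simp: arcs_def)
  show ?thesis unfolding \<alpha> by (rule cone_rays_deformations)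
qed

end
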